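(* Let $L>0$ and let $h\in C([-L,L])$ be an even real-valued continuous function. Let $K$ be the operator on $L^2([0,L])$ given by $$(Kf)(x)=\int_0^L h(x-y)f(y)\,dy .$$ Then $K$ is a compact selfadjoint operator. Assume that its eigenvalue of largest modulus is simple and let $\xi\in L^2([0,L])$ be its (nonzero) eigenvector. If $\xi$ is extended to an element of $L^2(\mathbb{R})$ by zero outside $[0,L]$, then all the zeros of the entire function $\widehat\xi(s)=\int_{\mathbb{R}}\xi(x)e^{-isx}\,dx$, $s\in\mathbb{C}$, belong to $\mathbb{R}\subset\mathbb{C}$.
   Context: An eigenvalue is simple if its eigenspace is one-dimensional. *)

theory Defs
  imports "HOL-Analysis.Analysis"
begin

text \<open>
  Elements of the complex Hilbert space \<open>L\<^sup>2(M)\<close> are represented by square-integrable functions;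
  two functions represent the same element iff they agree almost everywhere.  Operators on
  \<open>L\<^sup>2(M)\<close> are represented by maps on functions that respect this equality.
\<close>

definition L2_space :: "'a measure \<Rightarrow> ('a \<Rightarrow> complex) set" where
  "L2_space M = {f. f \<in> borel_measurable M \<and> integrable M (\<lambda>x. (cmod (f x))\<^sup>2)}"

definition L2_eq :: "'a measure \<Rightarrow> ('a \<Rightarrow> complex) \<Rightarrow> ('a \<Rightarrow> complex) \<Rightarrow> bool" where
  "L2_eq M f g \<longleftrightarrow> (AE x in M. f x = g x)"

definition L2_inner :: "'a measure \<Rightarrow> ('a \<Rightarrow> complex) \<Rightarrow> ('a \<Rightarrow> complex) \<Rightarrow> complex" where
  "L2_inner M f g = (LINT x|M. f x * cnj (g x))"

definition L2_norm :: "'a measure \<Rightarrow> ('a \<Rightarrow> complex) \<Rightarrow> real" where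
  "L2_norm M f = sqrt (LINT x|M. (cmod (f x))\<^sup>2)"

definition L2_bounded_operator ::
    "'a measure \<Rightarrow> (('a \<Rightarrow> complex) \<Rightarrow> 'a \<Rightarrow> complex) \<Rightarrow> bool" where
  "L2_bounded_operator M T \<longleftrightarrow>
     (\<forall>f\<in>L2_space M. T f \<in> L2_space M) \<and>
     (\<forall>f\<in>L2_space M. \<forall>g\<in>L2_space M. L2_eq M f g \<longrightarrow> L2_eq M (T f) (T g)) \<and>
     (\<forall>f\<in>L2_space M. \<forall>g\<in>L2_space M. L2_eq M (T (\<lambda>x. f x + g x)) (\<lambda>x. T f x + T g x)) \<and>
     (\<forall>c. \<forall>f\<in>L2_space M. L2_eq M (T (\<lambda>x. c * f x)) (\<lambda>x. c * T f x)) \<and>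
     (\<exists>B. \<forall>f\<in>L2_space M. L2_norm M (T f) \<le> B * L2_norm M f)"

definition L2_compact_operator ::
    "'a measure \<Rightarrow> (('a \<Rightarrow> complex) \<Rightarrow> 'a \<Rightarrow> complex) \<Rightarrow> bool" where
  "L2_compact_operator M T \<longleftrightarrow>
     L2_bounded_operator M T \<and>
     (\<forall>f :: nat \<Rightarrow> 'a \<Rightarrow> complex.
        (\<forall>n. f n \<in> L2_space M) \<and> (\<exists>B. \<forall>n. L2_norm M (f n) \<le> B) \<longrightarrow>
        (\<exists>r g. strict_mono r \<and> g \<in> L2_space M \<and>
           (\<lambda>n. L2_norm M (\<lambda>x. T (f (r n)) x - g x)) \<longlonglongrightarrow> 0))"

definition L2_selfadjoint_operator ::
    "'a measure \<Rightarrow> (('a \<Rightarrow> complex) \<Rightarrow> 'a \<Rightarrow> complex) \<Rightarrow> bool" where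
  "L2_selfadjoint_operator M T \<longleftrightarrow>
     L2_bounded_operator M T \<and>
     (\<forall>f\<in>L2_space M. \<forall>g\<in>L2_space M. L2_inner M (T f) g = L2_inner M f (T g))"

definition L2_eigenspace ::
    "'a measure \<Rightarrow> (('a \<Rightarrow> complex) \<Rightarrow> 'a \<Rightarrow> complex) \<Rightarrow> complex \<Rightarrow> ('a \<Rightarrow> complex) set" where
  "L2_eigenspace M T \<mu> = {f \<in> L2_space M. L2_eq M (T f) (\<lambda>x. \<mu> * f x)}"

definition L2_eigenvector ::
    "'a measure \<Rightarrow> (('a \<Rightarrow> complex) \<Rightarrow> 'a \<Rightarrow> complex) \<Rightarrow> complex \<Rightarrow> ('a \<Rightarrow> complex) \<Rightarrow> bool" where
  "L2_eigenvector M T \<mu> f \<longleftrightarrow> f \<in> L2_eigenspace M T \<mu> \<and> \<not> L2_eq M f (\<lambda>x. 0)"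

definition L2_eigenvalue ::
    "'a measure \<Rightarrow> (('a \<Rightarrow> complex) \<Rightarrow> 'a \<Rightarrow> complex) \<Rightarrow> complex \<Rightarrow> bool" where
  "L2_eigenvalue M T \<mu> \<longleftrightarrow> (\<exists>f. L2_eigenvector M T \<mu> f)"

text \<open>Simplicity: the eigenspace, modulo equality almost everywhere, is spanned by one
  nonzero vector.\<close>

definition L2_simple_eigenvalue ::
    "'a measure \<Rightarrow> (('a \<Rightarrow> complex) \<Rightarrow> 'a \<Rightarrow> complex) \<Rightarrow> complex \<Rightarrow> bool" where
  "L2_simple_eigenvalue M T \<mu> \<longleftrightarrow>
     (\<exists>f. L2_eigenvector M T \<mu> f \<and>
        (\<forall>g\<in>L2_eigenspace M T \<mu>. \<exists>c. L2_eq M g (\<lambda>x. c * f x)))"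

definition L2_largest_eigenvalue ::
    "'a measure \<Rightarrow> (('a \<Rightarrow> complex) \<Rightarrow> 'a \<Rightarrow> complex) \<Rightarrow> complex \<Rightarrow> bool" where
  "L2_largest_eigenvalue M T \<mu> \<longleftrightarrow>
     L2_eigenvalue M T \<mu> \<and> (\<forall>\<nu>. L2_eigenvalue M T \<nu> \<longrightarrow> cmod \<nu> \<le> cmod \<mu>)"

text \<open>Only the values of \<open>conv_operator h L f\<close> on \<open>[0, L]\<close> are meaningful; there the kernel
  evaluates \<open>h\<close> only on \<open>[-L, L]\<close>.\<close>

definition conv_operator :: "(real \<Rightarrow> real) \<Rightarrow> real \<Rightarrow> (real \<Rightarrow> complex) \<Rightarrow> real \<Rightarrow> complex" where
  "conv_operator h L f x = (LINT y|lebesgue_on {0..L}. complex_of_real (h (x - y)) * f y)"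

definition extend_by_zero :: "'a set \<Rightarrow> ('a \<Rightarrow> complex) \<Rightarrow> 'a \<Rightarrow> complex" where
  "extend_by_zero S f x = (if x \<in> S then f x else 0)"

definition fourier_transform :: "(real \<Rightarrow> complex) \<Rightarrow> complex \<Rightarrow> complex" where
  "fourier_transform f s = (LINT x|lebesgue. f x * exp (- (\<i> * s * complex_of_real x)))"

end

theory Submission
  imports Defs "HOL-Complex_Analysis.Great_Picard"
begin

text \<open>
  Self-adjointness and compactness give \<open>\<parallel>K\<parallel> = |\<mu>|\<close>, so that \<open>\<langle>K g, g\<rangle> = \<mu> \<langle>g, g\<rangle>\<close> already forces
  \<open>K g = \<mu> g\<close>.  Suppose the transform of \<open>\<xi>\<close> vanishes at a non-real \<open>s\<close>.  Then
  \<open>g x = exp (\<i> s x) \<integral>\<^sub>0\<^sup>x \<xi> t exp (- \<i> s t) dt\<close> vanishes at both end points of \<open>[0, L]\<close> and solves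
  \<open>g' = \<i> s g + \<xi>\<close>.  Since \<open>K\<close> is a convolution, it commutes with differentiation on such functions,
  so \<open>q u v = \<langle>K u, v\<rangle> - \<mu> \<langle>u, v\<rangle>\<close> satisfies \<open>q g' g + q g g' = 0\<close>.  As \<open>\<xi>\<close> lies in the kernel of \<open>q\<close>,
  this reads \<open>-2 Im s q g g = 0\<close>, whence \<open>K g = \<mu> g\<close>.  By simplicity \<open>g\<close> and \<open>\<xi>\<close> are proportional,
  so \<open>g\<close> is zero or solves a homogeneous linear first order equation with \<open>g 0 = 0\<close>; either way
  \<open>g = 0\<close> and \<open>\<xi> = 0\<close>.
\<close>

subsection \<open>Square-integrable functions and their operators\<close>

lemma borel_measurable_cnj [measurable]: "cnj \<in> borel_measurable borel"
  by (intro borel_measurable_continuous_onI continuous_intros)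

text \<open>Both products are dominated by \<open>|f|^2 + |g|^2\<close>, which is integrable by
  assumption.\<close>

lemma L2_space_integrable_mult:
  assumes "f \<in> L2_space M" "g \<in> L2_space M"
  shows "integrable M (\<lambda>x. f x * cnj (g x))" "integrable M (\<lambda>x. cmod (f x) * cmod (g x))"
proof -
  have m [measurable]: "f \<in> borel_measurable M" "g \<in> borel_measurable M"
    and i: "integrable M (\<lambda>x. (cmod (f x))\<^sup>2 + (cmod (g x))\<^sup>2)"
    using assms by (auto simp: L2_space_def)
  have b: "a * b \<le> a\<^sup>2 + b\<^sup>2" if "0 \<le> a" "0 \<le> b" for a b :: real
    using sum_squares_bound[of a b] that mult_nonneg_nonneg[OF that] by linarith
  show "integrable M (\<lambda>x. f x * cnj (g x))"
    by (rule Bochner_Integration.integrable_bound[OF i]) (auto simp: norm_mult b)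
  show "integrable M (\<lambda>x. cmod (f x) * cmod (g x))"
    by (rule Bochner_Integration.integrable_bound[OF i]) (auto simp: b)
qed

lemma L2_space_cmult: "f \<in> L2_space M \<Longrightarrow> (\<lambda>x. c * f x) \<in> L2_space M"
  by (auto simp: L2_space_def norm_mult power_mult_distrib)

lemma L2_space_add:
  assumes "f \<in> L2_space M" "g \<in> L2_space M"
  shows "(\<lambda>x. f x + g x) \<in> L2_space M"
proof -
  have m [measurable]: "f \<in> borel_measurable M" "g \<in> borel_measurable M"
    and i: "integrable M (\<lambda>x. 2 * (cmod (f x))\<^sup>2 + 2 * (cmod (g x))\<^sup>2)"
    using assms by (auto simp: L2_space_def)
  have b: "(cmod (u + v))\<^sup>2 \<le> 2 * (cmod u)\<^sup>2 + 2 * (cmod v)\<^sup>2" for u v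
  proof -
    have "(cmod (u + v))\<^sup>2 \<le> (cmod u + cmod v)\<^sup>2"
      by (simp add: norm_triangle_ineq power_mono)
    also have "\<dots> \<le> 2 * (cmod u)\<^sup>2 + 2 * (cmod v)\<^sup>2"
      using sum_squares_bound[of "cmod u" "cmod v"] by (simp add: power2_sum)
    finally show ?thesis .
  qed
  have "integrable M (\<lambda>x. (cmod (f x + g x))\<^sup>2)"
    by (rule Bochner_Integration.integrable_bound[OF i]) (auto simp: b)
  then show ?thesis by (simp add: L2_space_def)
qed

lemma L2_space_diff:
  assumes "f \<in> L2_space M" "g \<in> L2_space M"
  shows "(\<lambda>x. f x - g x) \<in> L2_space M"
  using L2_space_add[OF assms(1) L2_space_cmult[OF assms(2), of "-1"]] by simp

lemma L2_inner_add_left: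
  assumes "f \<in> L2_space M" "g \<in> L2_space M" "k \<in> L2_space M"
  shows "L2_inner M (\<lambda>x. f x + g x) k = L2_inner M f k + L2_inner M g k"
  unfolding L2_inner_def
  using assms by (simp add: distrib_right L2_space_integrable_mult)

lemma L2_inner_cmult_left: "L2_inner M (\<lambda>x. c * f x) k = c * L2_inner M f k"
  unfolding L2_inner_def by (simp add: mult.assoc)

lemma L2_inner_cnj: "L2_inner M g f = cnj (L2_inner M f g)"
  unfolding L2_inner_def
  using Bochner_Integration.integral_cnj[of M "\<lambda>x. f x * cnj (g x)"] by (simp add: mult.commute)

lemma L2_inner_add_right:
  assumes "f \<in> L2_space M" "g \<in> L2_space M" "k \<in> L2_space M"
  shows "L2_inner M k (\<lambda>x. f x + g x) = L2_inner M k f + L2_inner M k g"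
  using L2_inner_add_left[OF assms] L2_inner_cnj[of M k] by simp

lemma L2_inner_cmult_right: "L2_inner M k (\<lambda>x. c * f x) = cnj c * L2_inner M k f"
  using L2_inner_cmult_left[of M c f k] L2_inner_cnj[of M k] by simp

lemma L2_inner_cong:
  assumes "f \<in> L2_space M" "f' \<in> L2_space M" "g \<in> L2_space M" "g' \<in> L2_space M"
    "L2_eq M f f'" "L2_eq M g g'"
  shows "L2_inner M f g = L2_inner M f' g'"
proof -
  have [measurable]: "f \<in> borel_measurable M" "g \<in> borel_measurable M"
    "f' \<in> borel_measurable M" "g' \<in> borel_measurable M"
    using assms by (auto simp: L2_space_def)
  show ?thesis
    unfolding L2_inner_def using assms(5,6)
    by (intro integral_cong_AE) (auto simp: L2_eq_def)
qed

lemma L2_inner_self: "L2_inner M f f = complex_of_real ((L2_norm M f)\<^sup>2)"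
proof -
  have "f x * cnj (f x) = complex_of_real ((cmod (f x))\<^sup>2)" for x
    by (rule complex_norm_square[symmetric])
  then show ?thesis unfolding L2_inner_def L2_norm_def by (simp del: of_real_power)
qed

lemma L2_norm_nonneg [simp]: "0 \<le> L2_norm M f"
  by (simp add: L2_norm_def)

lemma L2_norm_cong:
  assumes "f \<in> L2_space M" "g \<in> L2_space M" "L2_eq M f g"
  shows "L2_norm M f = L2_norm M g"
proof -
  have "complex_of_real ((L2_norm M f)\<^sup>2) = complex_of_real ((L2_norm M g)\<^sup>2)"
    using L2_inner_cong[OF assms(1,2) assms(1,2) assms(3,3)] unfolding L2_inner_self .
  then show ?thesis
    by (metis L2_norm_nonneg of_real_eq_iff power2_eq_iff_nonneg)
qed

lemma L2_norm_cmult: "L2_norm M (\<lambda>x. c * f x) = cmod c * L2_norm M f"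
  by (simp add: L2_norm_def norm_mult power_mult_distrib real_sqrt_mult)

lemma L2_norm_minus_commute: "L2_norm M (\<lambda>x. f x - g x) = L2_norm M (\<lambda>x. g x - f x)"
  by (simp add: L2_norm_def norm_minus_commute)

lemma L2_norm_eq_0_iff:
  assumes "f \<in> L2_space M"
  shows "L2_norm M f = 0 \<longleftrightarrow> L2_eq M f (\<lambda>x. 0)"
  using assms unfolding L2_norm_def L2_eq_def L2_space_def
  by (auto simp: integral_nonneg_eq_0_iff_AE)

text \<open>Transferred from the inequality for nonnegative extended integrals. With moduli inside
  the integral it bounds the inner product and also, against the constant 1, the integral of
  \<open>|f|\<close>.\<close>

lemma L2_Cauchy_Schwarz:
  assumes "f \<in> L2_space M" "g \<in> L2_space M"
  shows "(LINT x|M. cmod (f x) * cmod (g x)) \<le> L2_norm M f * L2_norm M g"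
proof -
  have [measurable]: "f \<in> borel_measurable M" "g \<in> borel_measurable M"
    and i: "integrable M (\<lambda>x. (cmod (f x))\<^sup>2)" "integrable M (\<lambda>x. (cmod (g x))\<^sup>2)"
    using assms by (auto simp: L2_space_def)
  define A B C where "A = (LINT x|M. (cmod (f x))\<^sup>2)" and "B = (LINT x|M. cmod (f x) * cmod (g x))"
    and "C = (LINT x|M. (cmod (g x))\<^sup>2)"
  have nn: "0 \<le> A" "0 \<le> B" "0 \<le> C" by (simp_all add: A_def B_def C_def)
  have "(\<integral>\<^sup>+x. ennreal (cmod (f x)) * ennreal (cmod (g x)) \<partial>M)\<^sup>2
      \<le> (\<integral>\<^sup>+x. ennreal (cmod (f x)) ^ 2 \<partial>M) * (\<integral>\<^sup>+x. ennreal (cmod (g x)) ^ 2 \<partial>M)"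
    by (rule Cauchy_Schwarz_nn_integral) auto
  moreover have "(\<integral>\<^sup>+x. ennreal (cmod (f x)) * ennreal (cmod (g x)) \<partial>M) = ennreal B"
    unfolding B_def using L2_space_integrable_mult(2)[OF assms]
    by (simp flip: ennreal_mult add: nn_integral_eq_integral)
  moreover have "(\<integral>\<^sup>+x. ennreal (cmod (f x)) ^ 2 \<partial>M) = ennreal A"
    "(\<integral>\<^sup>+x. ennreal (cmod (g x)) ^ 2 \<partial>M) = ennreal C"
    unfolding A_def C_def using i by (simp_all add: ennreal_power nn_integral_eq_integral)
  ultimately have "ennreal (B\<^sup>2) \<le> ennreal (A * C)"
    using nn by (simp add: ennreal_power ennreal_mult)
  then have "B\<^sup>2 \<le> A * C" using nn by (simp add: ennreal_le_iff)
  then have "B \<le> sqrt (A * C)" by (rule real_le_rsqrt)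
  then show ?thesis by (simp add: A_def B_def C_def L2_norm_def real_sqrt_mult)
qed

lemma L2_norm_add_square:
  assumes "f \<in> L2_space M" "g \<in> L2_space M"
  shows "(L2_norm M (\<lambda>x. f x + g x))\<^sup>2
    = (L2_norm M f)\<^sup>2 + 2 * Re (L2_inner M f g) + (L2_norm M g)\<^sup>2"
proof -
  have "complex_of_real ((L2_norm M (\<lambda>x. f x + g x))\<^sup>2)
      = L2_inner M (\<lambda>x. f x + g x) (\<lambda>x. f x + g x)"
    by (simp add: L2_inner_self)
  also have "\<dots> = L2_inner M f f + (L2_inner M f g + cnj (L2_inner M f g)) + L2_inner M g g"
    using assms
    by (simp add: L2_inner_add_left L2_inner_add_right L2_space_add L2_inner_cnj[of M g f])
  also have "\<dots> = complex_of_real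
      ((L2_norm M f)\<^sup>2 + 2 * Re (L2_inner M f g) + (L2_norm M g)\<^sup>2)"
    by (simp add: L2_inner_self complex_add_cnj)
  finally show ?thesis unfolding of_real_eq_iff .
qed

text \<open>Both spectral arguments below take for \<open>f\<close> an image of \<open>g\<close>
  under an operator. The expansion then turns information on the inner product \<open><f, g>\<close>
  into smallness of \<open>f - c g\<close>.\<close>

lemma L2_norm_diff_cmult_square:
  assumes "f \<in> L2_space M" "g \<in> L2_space M"
  shows "(L2_norm M (\<lambda>x. f x - complex_of_real c * g x))\<^sup>2
    = (L2_norm M f)\<^sup>2 - 2 * c * Re (L2_inner M f g) + c\<^sup>2 * (L2_norm M g)\<^sup>2"
  using L2_norm_add_square[OF assms(1) L2_space_cmult[OF assms(2), of "- complex_of_real c"]]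
  unfolding L2_inner_cmult_right L2_norm_cmult by (simp add: power_mult_distrib)

lemma L2_norm_triangle:
  assumes "f \<in> L2_space M" "g \<in> L2_space M"
  shows "L2_norm M (\<lambda>x. f x + g x) \<le> L2_norm M f + L2_norm M g"
proof (rule power2_le_imp_le)
  have "Re (L2_inner M f g) \<le> cmod (L2_inner M f g)" by (rule complex_Re_le_cmod)
  also have "\<dots> \<le> (LINT x|M. cmod (f x) * cmod (g x))"
    unfolding L2_inner_def by (rule order_trans[OF integral_norm_bound]) (simp add: norm_mult)
  also have "\<dots> \<le> L2_norm M f * L2_norm M g" by (rule L2_Cauchy_Schwarz[OF assms])
  finally show "(L2_norm M (\<lambda>x. f x + g x))\<^sup>2 \<le> (L2_norm M f + L2_norm M g)\<^sup>2"
    by (simp add: L2_norm_add_square[OF assms] power2_sum)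
qed simp

text \<open>The intermediate function stands first in both differences because the limits in the
  norm argument arise in that order.\<close>

lemma L2_norm_triangle_diff:
  assumes "f \<in> L2_space M" "g \<in> L2_space M" "k \<in> L2_space M"
  shows "L2_norm M (\<lambda>x. f x - k x)
    \<le> L2_norm M (\<lambda>x. g x - f x) + L2_norm M (\<lambda>x. g x - k x)"
proof -
  have "L2_norm M (\<lambda>x. f x - k x) \<le> L2_norm M (\<lambda>x. f x - g x) + L2_norm M (\<lambda>x. g x - k x)"
    using L2_norm_triangle[OF L2_space_diff[OF assms(1,2)] L2_space_diff[OF assms(2,3)]] by simp
  then show ?thesis by (simp add: L2_norm_minus_commute[of M f g])
qed

section \<open>Bounded operators, the operator norm, and eigenvalues of self-adjoint
  operators\<close>

lemma L2_bounded_operatorD: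
  assumes "L2_bounded_operator M T"
  shows "f \<in> L2_space M \<Longrightarrow> T f \<in> L2_space M"
    and "f \<in> L2_space M \<Longrightarrow> g \<in> L2_space M \<Longrightarrow> L2_eq M f g \<Longrightarrow> L2_eq M (T f) (T g)"
    and "f \<in> L2_space M \<Longrightarrow> g \<in> L2_space M \<Longrightarrow>
      L2_eq M (T (\<lambda>x. f x + g x)) (\<lambda>x. T f x + T g x)"
    and "f \<in> L2_space M \<Longrightarrow> L2_eq M (T (\<lambda>x. c * f x)) (\<lambda>x. c * T f x)"
    and "\<exists>B. \<forall>f\<in>L2_space M. L2_norm M (T f) \<le> B * L2_norm M f"
  using assms unfolding L2_bounded_operator_def by auto

lemma L2_bounded_operator_diff:
  assumes T: "L2_bounded_operator M T" and f: "f \<in> L2_space M" and g: "g \<in> L2_space M"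
  shows "L2_eq M (T (\<lambda>x. f x - c * g x)) (\<lambda>x. T f x - c * T g x)"
proof -
  have "L2_eq M (T (\<lambda>x. f x + (- c) * g x)) (\<lambda>x. T f x + T (\<lambda>x. (- c) * g x) x)"
    by (intro L2_bounded_operatorD(3)[OF T] f L2_space_cmult g)
  moreover have "L2_eq M (T (\<lambda>x. (- c) * g x)) (\<lambda>x. (- c) * T g x)"
    by (rule L2_bounded_operatorD(4)[OF T g])
  ultimately show ?thesis unfolding L2_eq_def by eventually_elim simp
qed

lemma L2_norm_operator_diff:
  assumes T: "L2_bounded_operator M T" and f: "f \<in> L2_space M" and g: "g \<in> L2_space M"
  shows "L2_norm M (T (\<lambda>x. f x - c * g x)) = L2_norm M (\<lambda>x. T f x - c * T g x)"
  by (intro L2_norm_cong L2_bounded_operatorD(1)[OF T] L2_space_diff L2_space_cmult f g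
      L2_bounded_operator_diff T)

text \<open>\<open>S\<close> is the operator norm, taken as a supremum over the closed unit ball;
  the sequence comes from approximating this supremum to within \<open>1 / (n + 1)\<close>.\<close>

lemma norming_sequence:
  assumes T: "L2_bounded_operator M T"
  obtains S f where "0 \<le> S" "\<And>f. f \<in> L2_space M \<Longrightarrow> L2_norm M (T f) \<le> S * L2_norm M f"
    "\<And>n::nat. f n \<in> L2_space M" "\<And>n. L2_norm M (f n) \<le> 1" "(\<lambda>n. L2_norm M (T (f n))) \<longlonglongrightarrow> S"
proof -
  obtain B where B: "\<And>f. f \<in> L2_space M \<Longrightarrow> L2_norm M (T f) \<le> B * L2_norm M f"
    using L2_bounded_operatorD(5)[OF T] by auto
  define N where "N = (\<lambda>f. L2_norm M (T f)) ` {f \<in> L2_space M. L2_norm M f \<le> 1}"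
  define S where "S = Sup N"
  have bdd: "bdd_above N"
  proof
    fix y assume "y \<in> N"
    then obtain f where f: "f \<in> L2_space M" "L2_norm M f \<le> 1" "y = L2_norm M (T f)"
      by (auto simp: N_def)
    have "y \<le> B * L2_norm M f" using B f by auto
    also have "\<dots> \<le> \<bar>B\<bar> * 1" by (intro mult_mono) (use f in auto)
    finally show "y \<le> \<bar>B\<bar>" by simp
  qed
  have z: "(\<lambda>x. 0) \<in> L2_space M" "L2_norm M (\<lambda>x. 0) = 0"
    by (auto simp: L2_space_def L2_norm_def)
  have ne: "N \<noteq> {}" using z by (auto simp: N_def intro!: exI[of _ "\<lambda>x. 0"])
  have upper: "L2_norm M (T f) \<le> S" if "f \<in> L2_space M" "L2_norm M f \<le> 1" for f
    unfolding S_def by (rule cSup_upper[OF _ bdd]) (use that in \<open>auto simp: N_def\<close>)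
  have S0: "0 \<le> S" using upper[of "\<lambda>x. 0"] z order_trans[OF L2_norm_nonneg] by auto
  have bound: "L2_norm M (T f) \<le> S * L2_norm M f" if f: "f \<in> L2_space M" for f
  \<comment> \<open>A vector of norm zero cannot be normalised; for it the a priori bound with
    \<open>B\<close> already gives \<open>L2_norm M (T f) = 0\<close>.\<close>
  proof (cases "L2_norm M f = 0")
    case True
    then show ?thesis using B[OF f] by simp
  next
    case False
    define c where "c = complex_of_real (inverse (L2_norm M f))"
    have c: "cmod c = inverse (L2_norm M f)" by (simp add: c_def norm_inverse)
    have "L2_norm M (T (\<lambda>x. c * f x)) \<le> S"
      using False by (intro upper L2_space_cmult f) (simp add: L2_norm_cmult c)
    moreover have "L2_norm M (T (\<lambda>x. c * f x)) = cmod c * L2_norm M (T f)"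
      unfolding L2_norm_cmult[symmetric]
      by (intro L2_norm_cong L2_bounded_operatorD(1,4)[OF T] L2_space_cmult f)
    ultimately have "inverse (L2_norm M f) * L2_norm M (T f) \<le> S" by (simp add: c)
    moreover have "L2_norm M f > 0" using False L2_norm_nonneg[of M f] by linarith
    ultimately show ?thesis by (simp add: field_simps)
  qed
  have "\<exists>f. f \<in> L2_space M \<and> L2_norm M f \<le> 1 \<and> S - inverse (real (Suc n)) < L2_norm M (T f)" for n
  proof -
    have "S - inverse (real (Suc n)) < Sup N" by (simp add: S_def)
    then show ?thesis unfolding less_cSup_iff[OF ne bdd] by (auto simp: N_def)
  qed
  then obtain f where f: "\<And>n::nat. f n \<in> L2_space M" "\<And>n. L2_norm M (f n) \<le> 1"
    "\<And>n. S - inverse (real (Suc n)) < L2_norm M (T (f n))" by metis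
  have "(\<lambda>n. S - inverse (real (Suc n))) \<longlonglongrightarrow> S"
    using tendsto_diff[OF tendsto_const LIMSEQ_inverse_real_of_nat, of S] by simp
  then have "(\<lambda>n. L2_norm M (T (f n))) \<longlonglongrightarrow> S"
    by (rule tendsto_sandwich[rotated 2, OF _ tendsto_const])
       (intro always_eventually allI upper f less_imp_le[OF f(3)])+
  then show thesis using that S0 bound f by blast
qed

text \<open>
  Along a norming sequence \<open>v\<close> one has \<open>T (T v) - S\<^sup>2 v \<rightarrow> 0\<close> with \<open>S = \<parallel>T\<parallel>\<close>, so a limit \<open>g\<close> of \<open>T v\<close>, which
  compactness provides, satisfies \<open>T (T g) = S\<^sup>2 g\<close>.  Hence \<open>T g + S g\<close>, or \<open>g\<close> if that vanishes, is an
  eigenvector for \<open>S\<close> or \<open>-S\<close>.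
\<close>

lemma L2_selfadjoint_norm_le:
  assumes C: "L2_compact_operator M T" and A: "L2_selfadjoint_operator M T"
    and max: "\<And>\<nu>. L2_eigenvalue M T \<nu> \<Longrightarrow> cmod \<nu> \<le> r"
    and r: "0 \<le> r" and f: "f \<in> L2_space M"
  shows "L2_norm M (T f) \<le> r * L2_norm M f"
proof -
  have T: "L2_bounded_operator M T" using C by (simp add: L2_compact_operator_def)
  note TI = L2_bounded_operatorD(1)[OF T] and sp = L2_space_diff L2_space_cmult L2_space_add
  obtain S v where S0: "0 \<le> S" and bound: "\<And>f. f \<in> L2_space M \<Longrightarrow> L2_norm M (T f) \<le> S * L2_norm M f"
    and v: "\<And>n::nat. v n \<in> L2_space M" "\<And>n. L2_norm M (v n) \<le> 1"
    and lim: "(\<lambda>n. L2_norm M (T (v n))) \<longlonglongrightarrow> S"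
    by (rule norming_sequence[OF T]) blast
  have "S \<le> r"
  proof (cases "S = 0")
    case False
    then have S: "0 < S" using S0 by simp
    obtain k g where k: "strict_mono k" and g: "g \<in> L2_space M"
      and lim_g: "(\<lambda>n. L2_norm M (\<lambda>x. T (v (k n)) x - g x)) \<longlonglongrightarrow> 0"
      using C v unfolding L2_compact_operator_def by meson
    define u where "u n = v (k n)" for n
    have u: "u n \<in> L2_space M" "L2_norm M (u n) \<le> 1" for n using v by (auto simp: u_def)
    have lim_u: "(\<lambda>n. L2_norm M (T (u n))) \<longlonglongrightarrow> S"
      using LIMSEQ_subseq_LIMSEQ[OF lim k] by (simp add: o_def u_def)
    have lim_g: "(\<lambda>n. L2_norm M (\<lambda>x. T (u n) x - g x)) \<longlonglongrightarrow> 0" using lim_g by (simp add: u_def)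
    define c where "c = complex_of_real (S\<^sup>2)"
    \<comment> \<open>Expanding the square gives \<open>|TTu|^2 - 2 S^2 |Tu|^2 + S^4 |u|^2\<close>,
      since self-adjointness makes the cross term \<open><TTu, u> = |Tu|^2\<close>. Then
      \<open>|TTu| \<le> S |Tu|\<close> and \<open>|u| \<le> 1\<close> leave the bound, which tends
      to 0 because \<open>|Tu|\<close> tends to \<open>S\<close>.\<close>
    have step: "(L2_norm M (\<lambda>x. T (T (u n)) x - c * u n x))\<^sup>2 \<le> S\<^sup>2 * (S\<^sup>2 - (L2_norm M (T (u n)))\<^sup>2)"
      for n
    proof -
      have "L2_inner M (T (T (u n))) (u n) = L2_inner M (T (u n)) (T (u n))"
        using A u TI by (simp add: L2_selfadjoint_operator_def)
      then have re: "Re (L2_inner M (T (T (u n))) (u n)) = (L2_norm M (T (u n)))\<^sup>2"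
        by (simp add: L2_inner_self)
      have "(L2_norm M (T (T (u n))))\<^sup>2 \<le> (S * L2_norm M (T (u n)))\<^sup>2"
        by (intro power_mono bound TI u) simp
      moreover have "(L2_norm M (u n))\<^sup>2 \<le> 1" using u by (simp add: power_le_one)
      then have "S\<^sup>2 * S\<^sup>2 * (L2_norm M (u n))\<^sup>2 \<le> S\<^sup>2 * S\<^sup>2 * 1"
        by (intro mult_left_mono) auto
      moreover have "(L2_norm M (\<lambda>x. T (T (u n)) x - c * u n x))\<^sup>2 = (L2_norm M (T (T (u n))))\<^sup>2
          - 2 * S\<^sup>2 * (L2_norm M (T (u n)))\<^sup>2 + S\<^sup>2 * S\<^sup>2 * (L2_norm M (u n))\<^sup>2"
        unfolding c_def L2_norm_diff_cmult_square[OF TI[OF TI[OF u(1)]] u(1)] re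
        by (simp add: power2_eq_square)
      ultimately show ?thesis by (simp add: power_mult_distrib algebra_simps)
    qed
    have "(\<lambda>n. S\<^sup>2 * (S\<^sup>2 - (L2_norm M (T (u n)))\<^sup>2)) \<longlonglongrightarrow> S\<^sup>2 * (S\<^sup>2 - S\<^sup>2)"
      by (intro tendsto_intros lim_u)
    then have "(\<lambda>n. S\<^sup>2 * (S\<^sup>2 - (L2_norm M (T (u n)))\<^sup>2)) \<longlonglongrightarrow> 0" by simp
    then have "(\<lambda>n. (L2_norm M (\<lambda>x. T (T (u n)) x - c * u n x))\<^sup>2) \<longlonglongrightarrow> 0"
      by (rule Lim_null_comparison[rotated]) (simp add: step)
    from tendsto_real_sqrt[OF this]
    have lim1: "(\<lambda>n. L2_norm M (\<lambda>x. T (T (u n)) x - c * u n x)) \<longlonglongrightarrow> 0" by simp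
    \<comment> \<open>Boundedness of \<open>T\<close> carries norm limits through
      \<open>T\<close>.\<close>
    have lim_T: "(\<lambda>n. L2_norm M (\<lambda>x. T (f n) x - d * T k x)) \<longlonglongrightarrow> 0"
      if "(\<lambda>n. L2_norm M (\<lambda>x. f n x - d * k x)) \<longlonglongrightarrow> 0" "\<And>n. f n \<in> L2_space M" "k \<in> L2_space M"
      for f k d
    proof (rule tendsto_sandwich[OF _ _ tendsto_const])
      show "\<forall>\<^sub>F n in sequentially. L2_norm M (\<lambda>x. T (f n) x - d * T k x)
          \<le> S * L2_norm M (\<lambda>x. f n x - d * k x)"
        using bound[OF L2_space_diff[OF that(2) L2_space_cmult[OF that(3)]]]
          L2_norm_operator_diff[OF T that(2,3)] by (intro always_eventually) simp
      show "(\<lambda>n. S * L2_norm M (\<lambda>x. f n x - d * k x)) \<longlonglongrightarrow> 0"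
        using tendsto_mult[OF tendsto_const that(1), of S] by simp
    qed simp
    have lim2: "(\<lambda>n. L2_norm M (\<lambda>x. T (T (u n)) x - T g x)) \<longlonglongrightarrow> 0"
      using lim_T[of "\<lambda>n. T (u n)" 1 g] lim_g g u TI by simp
    \<comment> \<open>\<open>T (T (u n))\<close> approaches both \<open>c u n\<close> and
      \<open>T g\<close>. Applying \<open>T\<close> once more makes \<open>c T (u n)\<close>
      approach \<open>T (T g)\<close>, while it also approaches \<open>c g\<close>; uniqueness of
      the limit gives \<open>T (T g) = c g\<close>.\<close>
    have lim3: "(\<lambda>n. L2_norm M (\<lambda>x. c * u n x - T g x)) \<longlonglongrightarrow> 0"
    proof (rule tendsto_sandwich[OF _ _ tendsto_const])
      show "\<forall>\<^sub>F n in sequentially. L2_norm M (\<lambda>x. c * u n x - T g x)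
          \<le> L2_norm M (\<lambda>x. T (T (u n)) x - c * u n x) + L2_norm M (\<lambda>x. T (T (u n)) x - T g x)"
        by (intro always_eventually allI L2_norm_triangle_diff sp TI u g)
      show "(\<lambda>n. L2_norm M (\<lambda>x. T (T (u n)) x - c * u n x)
          + L2_norm M (\<lambda>x. T (T (u n)) x - T g x)) \<longlonglongrightarrow> 0"
        using tendsto_add[OF lim1 lim2] by simp
    qed simp
    have "(\<lambda>n. L2_norm M (\<lambda>x. T (\<lambda>x. c * u n x) x - T (T g) x)) \<longlonglongrightarrow> 0"
      using lim_T[of "\<lambda>n x. c * u n x" 1 "T g"] lim3 g u TI by (simp add: L2_space_cmult)
    moreover have "L2_norm M (\<lambda>x. T (\<lambda>x. c * u n x) x - T (T g) x)
        = L2_norm M (\<lambda>x. c * T (u n) x - T (T g) x)" for n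
      using L2_bounded_operatorD(4)[OF T u(1)]
      by (intro L2_norm_cong sp TI u g) (auto simp: L2_eq_def)
    ultimately have lim4: "(\<lambda>n. L2_norm M (\<lambda>x. c * T (u n) x - T (T g) x)) \<longlonglongrightarrow> 0" by simp
    have "L2_norm M (\<lambda>x. c * T (u n) x - c * g x) = cmod c * L2_norm M (\<lambda>x. T (u n) x - g x)" for n
      by (simp flip: L2_norm_cmult add: right_diff_distrib)
    then have lim5: "(\<lambda>n. L2_norm M (\<lambda>x. c * T (u n) x - c * g x)) \<longlonglongrightarrow> 0"
      using tendsto_mult[OF tendsto_const lim_g, of "cmod c"] by simp
    have "L2_norm M (\<lambda>x. T (T g) x - c * g x) \<le> 0"
    proof (rule tendsto_lowerbound)
      show "(\<lambda>n. L2_norm M (\<lambda>x. c * T (u n) x - T (T g) x)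
          + L2_norm M (\<lambda>x. c * T (u n) x - c * g x)) \<longlonglongrightarrow> 0"
        using tendsto_add[OF lim4 lim5] by simp
      show "\<forall>\<^sub>F n in sequentially. L2_norm M (\<lambda>x. T (T g) x - c * g x)
          \<le> L2_norm M (\<lambda>x. c * T (u n) x - T (T g) x) + L2_norm M (\<lambda>x. c * T (u n) x - c * g x)"
        by (intro always_eventually allI L2_norm_triangle_diff sp TI u g)
    qed simp
    then have "L2_norm M (\<lambda>x. T (T g) x - c * g x) = 0"
      by (simp add: order_antisym)
    then have TTg: "AE x in M. T (T g) x = c * g x"
      using L2_norm_eq_0_iff[of "\<lambda>x. T (T g) x - c * g x" M] g TI by (simp add: sp L2_eq_def)
    \<comment> \<open>If \<open>g\<close> were zero, the norms of \<open>T (u n)\<close> would tend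
      to 0 instead of to \<open>S > 0\<close>.\<close>
    have g0: "\<not> L2_eq M g (\<lambda>x. 0)"
    proof
      assume "L2_eq M g (\<lambda>x. 0)"
      then have "L2_norm M (\<lambda>x. T (u n) x - g x) = L2_norm M (T (u n))" for n
        by (intro L2_norm_cong sp TI u g) (auto simp: L2_eq_def)
      then have "S = 0" using LIMSEQ_unique[OF lim_u] lim_g by simp
      then show False using S by simp
    qed
    \<comment> \<open>From \<open>(T - S) (T + S) g = 0\<close>: either \<open>w = (T + S) g\<close>
      is nonzero and belongs to the eigenvalue \<open>S\<close>, or \<open>g\<close> itself belongs
      to \<open>-S\<close>.\<close>
    define w where "w x = T g x + complex_of_real S * g x" for x
    have w: "w \<in> L2_space M" unfolding w_def by (intro sp TI g)
    have "\<exists>\<nu>. L2_eigenvalue M T \<nu> \<and> cmod \<nu> = S"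
    proof (cases "L2_eq M w (\<lambda>x. 0)")
      case True
      then have "L2_eq M (T g) (\<lambda>x. complex_of_real (- S) * g x)"
        unfolding L2_eq_def w_def by eventually_elim (simp add: add_eq_0_iff)
      then have "L2_eigenvector M T (complex_of_real (- S)) g"
        using g g0 by (simp add: L2_eigenvector_def L2_eigenspace_def)
      then show ?thesis using S0
        by (intro exI[of _ "complex_of_real (- S)"]) (auto simp: L2_eigenvalue_def)
    next
      case False
      have "L2_eq M (T w) (\<lambda>x. T (T g) x + T (\<lambda>x. complex_of_real S * g x) x)"
        unfolding w_def by (intro L2_bounded_operatorD(3)[OF T] sp TI g)
      moreover have "L2_eq M (T (\<lambda>x. complex_of_real S * g x)) (\<lambda>x. complex_of_real S * T g x)"
        by (rule L2_bounded_operatorD(4)[OF T g])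
      ultimately have "L2_eq M (T w) (\<lambda>x. complex_of_real S * w x)"
        using TTg unfolding L2_eq_def w_def
        by eventually_elim (simp add: c_def algebra_simps power2_eq_square)
      then have "L2_eigenvector M T (complex_of_real S) w"
        using w False by (simp add: L2_eigenvector_def L2_eigenspace_def)
      then show ?thesis using S0
        by (intro exI[of _ "complex_of_real S"]) (auto simp: L2_eigenvalue_def)
    qed
    then show ?thesis using max by auto
  qed (use r in simp)
  then show ?thesis using bound[OF f] mult_right_mono[OF _ L2_norm_nonneg] order_trans by blast
qed

text \<open>Moving \<open>T\<close> across \<open><T f, f>\<close> yields
  \<open>\<mu> |f|^2 = cnj \<mu> |f|^2\<close> for an eigenvector \<open>f\<close>, whose norm is
  nonzero.\<close>

lemma L2_eigenvalue_selfadjoint_real: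
  assumes A: "L2_selfadjoint_operator M T" and E: "L2_eigenvalue M T \<mu>"
  shows "\<mu> = complex_of_real (Re \<mu>)"
proof -
  obtain f where f: "f \<in> L2_space M" "L2_eq M (T f) (\<lambda>x. \<mu> * f x)" "\<not> L2_eq M f (\<lambda>x. 0)"
    using E by (auto simp: L2_eigenvalue_def L2_eigenvector_def L2_eigenspace_def)
  have T: "L2_bounded_operator M T" using A by (simp add: L2_selfadjoint_operator_def)
  note sp = L2_bounded_operatorD(1)[OF T f(1)] f(1) L2_space_cmult[OF f(1), of \<mu>]
  have r: "L2_eq M f f" by (simp add: L2_eq_def)
  have "L2_inner M (T f) f = L2_inner M f (T f)"
    using A f by (simp add: L2_selfadjoint_operator_def)
  moreover have "L2_inner M (T f) f = L2_inner M (\<lambda>x. \<mu> * f x) f"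
    by (rule L2_inner_cong[OF sp(1,3,2,2) f(2) r])
  moreover have "L2_inner M f (T f) = L2_inner M f (\<lambda>x. \<mu> * f x)"
    by (rule L2_inner_cong[OF sp(2,2,1,3) r f(2)])
  ultimately have "\<mu> * L2_inner M f f = cnj \<mu> * L2_inner M f f"
    by (simp add: L2_inner_cmult_left L2_inner_cmult_right)
  moreover have "L2_inner M f f \<noteq> 0"
    using L2_norm_eq_0_iff[OF f(1)] f(3) by (simp add: L2_inner_self)
  ultimately have "cnj \<mu> = \<mu>" by simp
  then show ?thesis by (metis Reals_cnj_iff of_real_Re)
qed

text \<open>The extremal case of the Rayleigh quotient:
  \<open>|T g - m g|^2 = |T g|^2 - 2 m^2 |g|^2 + m^2 |g|^2\<close>, and the norm bound makes this at
  most 0.\<close>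

lemma L2_eigenspace_if_Rayleigh_eq:
  assumes T: "L2_bounded_operator M T" and g: "g \<in> L2_space M"
    and bound: "L2_norm M (T g) \<le> \<bar>m\<bar> * L2_norm M g"
    and eq: "L2_inner M (T g) g = complex_of_real m * L2_inner M g g"
  shows "g \<in> L2_eigenspace M T (complex_of_real m)"
proof -
  note Tg = L2_bounded_operatorD(1)[OF T g]
  have "(L2_norm M (T g))\<^sup>2 \<le> (\<bar>m\<bar> * L2_norm M g)\<^sup>2" by (intro power_mono bound) simp
  moreover have "Re (L2_inner M (T g) g) = m * (L2_norm M g)\<^sup>2"
    by (simp add: eq L2_inner_self)
  ultimately have "(L2_norm M (\<lambda>x. T g x - complex_of_real m * g x))\<^sup>2 \<le> 0"
    unfolding L2_norm_diff_cmult_square[OF Tg g]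
    by (simp add: power_mult_distrib) (simp add: power2_eq_square)
  then have "L2_norm M (\<lambda>x. T g x - complex_of_real m * g x) = 0" by simp
  then have "L2_eq M (T g) (\<lambda>x. complex_of_real m * g x)"
    using L2_norm_eq_0_iff[OF L2_space_diff[OF Tg L2_space_cmult[OF g]], of "complex_of_real m"]
    by (simp add: L2_eq_def)
  then show ?thesis using g by (simp add: L2_eigenspace_def)
qed

section \<open>Square-integrable and continuous functions on a compact interval\<close>

lemma L2_space_continuous_on:
  assumes "continuous_on {a..b::real} f"
  shows "f \<in> L2_space (lebesgue_on {a..b})"
proof -
  have "continuous_on {a..b} (\<lambda>x. (cmod (f x))\<^sup>2)" by (intro continuous_intros assms)
  then show ?thesis
    using assms unfolding L2_space_def
    by (auto intro: continuous_imp_measurable_on_sets_lebesgue continuous_imp_integrable_real)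
qed

lemma L2_norm_le_bound:
  assumes "f \<in> L2_space (lebesgue_on {a..b::real})" "\<And>x. x \<in> {a..b} \<Longrightarrow> cmod (f x) \<le> C" "a \<le> b"
  shows "L2_norm (lebesgue_on {a..b}) f \<le> sqrt (b - a) * C"
proof -
  have C: "0 \<le> C" using assms(2)[of a] assms(3) order_trans[OF norm_ge_zero] by auto
  have "(LINT x|lebesgue_on {a..b}. (cmod (f x))\<^sup>2) \<le> (LINT x|lebesgue_on {a..b}. C\<^sup>2)"
    using assms(1,2) by (intro integral_mono) (auto simp: L2_space_def intro!: power_mono)
  also have "\<dots> = (b - a) * C\<^sup>2"
    using assms(3) by (simp add: measure_restrict_space)
  finally have "sqrt (LINT x|lebesgue_on {a..b}. (cmod (f x))\<^sup>2) \<le> sqrt ((b - a) * C\<^sup>2)"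
    by (rule real_sqrt_le_mono)
  then show ?thesis using C by (simp add: L2_norm_def real_sqrt_mult)
qed

text \<open>Cauchy-Schwarz against the constant function 1, whose norm is
  \<open>sqrt (b - a)\<close>.\<close>

lemma L2_space_integrable:
  assumes "f \<in> L2_space (lebesgue_on {a..b::real})" "a \<le> b"
  shows "integrable (lebesgue_on {a..b}) f"
    and "(LINT x|lebesgue_on {a..b}. cmod (f x)) \<le> sqrt (b - a) * L2_norm (lebesgue_on {a..b}) f"
proof -
  have one: "(\<lambda>x. 1) \<in> L2_space (lebesgue_on {a..b})"
    by (rule L2_space_continuous_on) simp
  have n: "L2_norm (lebesgue_on {a..b}) (\<lambda>x. 1) = sqrt (b - a)"
    using assms(2) by (simp add: L2_norm_def measure_restrict_space)
  show "integrable (lebesgue_on {a..b}) f"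
    using L2_space_integrable_mult(1)[OF assms(1) one] by simp
  show "(LINT x|lebesgue_on {a..b}. cmod (f x)) \<le> sqrt (b - a) * L2_norm (lebesgue_on {a..b}) f"
    using L2_Cauchy_Schwarz[OF assms(1) one] by (simp add: n mult.commute)
qed

text \<open>A nonnegative continuous function with integral zero over a nondegenerate interval
  vanishes; here it is \<open>|f - g|\<close>. This recovers pointwise equations from equations
  between classes.\<close>

lemma continuous_AE_eq_imp_eq:
  fixes f g :: "real \<Rightarrow> complex"
  assumes "a < b" "continuous_on {a..b} f" "continuous_on {a..b} g"
    and ae: "AE x in lebesgue_on {a..b}. f x = g x" and x: "x \<in> {a..b}"
  shows "f x = g x"
proof -
  have c: "continuous_on {a..b} (\<lambda>x. cmod (f x - g x))"
    by (intro continuous_intros assms)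
  have i: "integrable (lebesgue_on {a..b}) (\<lambda>x. cmod (f x - g x))"
    by (rule continuous_imp_integrable_real[OF c])
  have "AE x in lebesgue_on {a..b}. cmod (f x - g x) = 0"
    using ae by eventually_elim simp
  then have "integral\<^sup>L (lebesgue_on {a..b}) (\<lambda>x. cmod (f x - g x)) = 0"
    using integral_nonneg_eq_0_iff_AE[OF i] by simp
  then have "integral {a..b} (\<lambda>x. cmod (f x - g x)) = 0"
    by (subst (asm) lebesgue_integral_eq_integral[OF i]) auto
  then show ?thesis using integral_eq_0_iff[OF c assms(1)] x by auto
qed

subsection \<open>Convolution operators on an interval\<close>

locale even_convolution_kernel =
  fixes L :: real and h :: "real \<Rightarrow> real"
  assumes L_pos: "0 < L"
    and cont_h: "continuous_on {-L..L} h"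
    and even_h: "x \<in> {-L..L} \<Longrightarrow> h (- x) = h x"
begin

abbreviation "M \<equiv> lebesgue_on {0..L}"
abbreviation "K \<equiv> conv_operator h L"

lemma h_bounded:
  obtains H where "\<And>u. u \<in> {-L..L} \<Longrightarrow> \<bar>h u\<bar> \<le> H"
proof -
  have "bounded (h ` {-L..L})"
    by (intro compact_imp_bounded compact_continuous_image cont_h) simp
  then have "\<exists>H. \<forall>u\<in>{-L..L}. \<bar>h u\<bar> \<le> H"
    unfolding bounded_iff by simp
  then show thesis using that by metis
qed

lemma kernel_even: "x \<in> {0..L} \<Longrightarrow> y \<in> {0..L} \<Longrightarrow> h (y - x) = h (x - y)"
  using even_h[of "x - y"] by simp

lemma kernel_integrable:
  assumes "f \<in> L2_space M" "x \<in> {0..L}"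
  shows "integrable M (\<lambda>y. complex_of_real (h (x - y)) * f y)"
proof -
  have "continuous_on {0..L} (\<lambda>y. complex_of_real (h (x - y)))"
    by (intro continuous_intros continuous_on_compose2[OF cont_h]) (use assms(2) in auto)
  then have "(\<lambda>y. complex_of_real (h (x - y))) \<in> L2_space M"
    by (rule L2_space_continuous_on)
  from L2_space_integrable_mult(1)[OF assms(1) this] show ?thesis
    by (simp add: mult.commute)
qed

text \<open>A modulus of continuity of \<open>h\<close> passes to \<open>K f\<close>, with a factor
  depending on \<open>f\<close> only through its norm; this uniformity is the source of
  equicontinuity.\<close>

lemma conv_operator_diff_le:
  assumes f: "f \<in> L2_space M" and x: "x \<in> {0..L}" "x' \<in> {0..L}"
    and e: "\<And>y. y \<in> {0..L} \<Longrightarrow> \<bar>h (x - y) - h (x' - y)\<bar> \<le> e"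
  shows "cmod (K f x - K f x') \<le> e * (sqrt L * L2_norm M f)"
proof -
  have e0: "0 \<le> e" using e[of 0] L_pos abs_ge_zero order_trans by fastforce
  have "K f x - K f x' = (LINT y|M. complex_of_real (h (x - y)) * f y - complex_of_real (h (x' - y)) * f y)"
    unfolding conv_operator_def
    by (intro Bochner_Integration.integral_diff[symmetric] kernel_integrable f x)
  also have "cmod \<dots> \<le> (LINT y|M. cmod (complex_of_real (h (x - y)) * f y - complex_of_real (h (x' - y)) * f y))"
    by (rule integral_norm_bound)
  also have "\<dots> \<le> (LINT y|M. e * cmod (f y))"
  proof (rule integral_mono)
    show "integrable M (\<lambda>y. cmod (complex_of_real (h (x - y)) * f y - complex_of_real (h (x' - y)) * f y))"
      by (intro integrable_norm Bochner_Integration.integrable_diff kernel_integrable f x)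
    show "integrable M (\<lambda>y. e * cmod (f y))"
      using L2_space_integrable[OF f] L_pos by simp
    show "cmod (complex_of_real (h (x - y)) * f y - complex_of_real (h (x' - y)) * f y) \<le> e * cmod (f y)"
      if "y \<in> space M" for y
    proof -
      have "complex_of_real (h (x - y)) * f y - complex_of_real (h (x' - y)) * f y
          = complex_of_real (h (x - y) - h (x' - y)) * f y" by (simp add: algebra_simps)
      then show ?thesis using e[of y] that
        by (simp only: norm_mult norm_of_real) (simp add: mult_right_mono)
    qed
  qed
  also have "\<dots> \<le> e * (sqrt L * L2_norm M f)"
    using L2_space_integrable(2)[OF f] L_pos e0 by (simp add: mult_left_mono)
  finally show ?thesis .
qed

text \<open>A pointwise bound by the \<open>L2\<close> norm: it yields boundedness of
  \<open>K\<close> and the uniform bound for Arzela-Ascoli.\<close>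

lemma conv_operator_bound:
  obtains H where "0 \<le> H"
    "\<And>f x. f \<in> L2_space M \<Longrightarrow> x \<in> {0..L} \<Longrightarrow> cmod (K f x) \<le> H * L2_norm M f"
proof -
  obtain H where H: "\<And>u. u \<in> {-L..L} \<Longrightarrow> \<bar>h u\<bar> \<le> H"
    by (rule h_bounded) blast
  have "\<bar>h 0\<bar> \<le> H" using L_pos by (intro H) simp
  then have H0: "0 \<le> H" by linarith
  have "cmod (K f x) \<le> H * sqrt L * L2_norm M f" if f: "f \<in> L2_space M" and x: "x \<in> {0..L}" for f x
  proof -
    have "cmod (K f x) \<le> (LINT y|M. cmod (complex_of_real (h (x - y)) * f y))"
      unfolding conv_operator_def by (rule integral_norm_bound)
    also have "\<dots> \<le> (LINT y|M. H * cmod (f y))"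
      using L2_space_integrable(1)[OF f] L_pos x
      by (intro integral_mono integrable_norm kernel_integrable f x)
         (auto simp: norm_mult intro!: mult_right_mono H)
    also have "\<dots> \<le> H * (sqrt L * L2_norm M f)"
      using L2_space_integrable(2)[OF f] L_pos H0 by (simp add: mult_left_mono)
    finally show ?thesis by (simp add: mult.assoc)
  qed
  then show thesis using that[of "H * sqrt L"] H0 L_pos by simp
qed

lemma conv_operator_equicontinuous:
  assumes "0 < e"
  obtains d where "0 < d"
    "\<And>f x y. f \<in> L2_space M \<Longrightarrow> L2_norm M f \<le> B \<Longrightarrow> x \<in> {0..L} \<Longrightarrow> y \<in> {0..L} \<Longrightarrow>
      \<bar>x - y\<bar> < d \<Longrightarrow> cmod (K f x - K f y) < e"
proof -
  \<comment> \<open>The summand 1 keeps the denominator positive even for \<open>B = 0\<close>, and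
    the factor 2 turns the final weak estimate into a strict one.\<close>
  define e' where "e' = e / (2 * (sqrt L * (\<bar>B\<bar> + 1)))"
  have sL: "0 < sqrt L * (\<bar>B\<bar> + 1)" using L_pos by simp
  then have e': "0 < e'" using assms by (simp add: e'_def)
  have "uniformly_continuous_on {-L..L} h"
    by (rule compact_uniformly_continuous[OF cont_h]) simp
  then obtain d where d: "0 < d"
    "\<And>u v. u \<in> {-L..L} \<Longrightarrow> v \<in> {-L..L} \<Longrightarrow> dist u v < d \<Longrightarrow> dist (h u) (h v) < e'"
    unfolding uniformly_continuous_on_def using e' by metis
  show thesis
  proof (rule that[OF d(1)])
    fix f x y assume f: "f \<in> L2_space M" "L2_norm M f \<le> B"
      and xy: "x \<in> {0..L}" "y \<in> {0..L}" "\<bar>x - y\<bar> < d"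
    have "\<bar>h (x - t) - h (y - t)\<bar> \<le> e'" if "t \<in> {0..L}" for t
      using d(2)[of "x - t" "y - t"] xy that by (simp add: dist_real_def)
    then have "cmod (K f x - K f y) \<le> e' * (sqrt L * L2_norm M f)"
      by (rule conv_operator_diff_le[OF f(1) xy(1,2)])
    also have "\<dots> \<le> e' * (sqrt L * (\<bar>B\<bar> + 1))"
      using f(2) L_pos e' by (intro mult_left_mono) auto
    also have "\<dots> = e / 2"
      using sL unfolding e'_def by (simp only: times_divide_eq_left mult_divide_mult_cancel_right)
    also have "\<dots> < e" using assms by simp
    finally show "cmod (K f x - K f y) < e" .
  qed
qed

lemma conv_operator_continuous_on:
  assumes "f \<in> L2_space M"
  shows "continuous_on {0..L} (K f)"
  unfolding continuous_on_iff dist_norm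
proof (intro ballI allI impI)
  fix x e :: real assume "x \<in> {0..L}" "0 < e"
  then show "\<exists>d>0. \<forall>x'\<in>{0..L}. norm (x' - x) < d \<longrightarrow> norm (K f x' - K f x) < e"
    using conv_operator_equicontinuous[of e "L2_norm M f"] assms by (metis order_refl real_norm_def)
qed

text \<open>The integral sees only the class of its argument, so the equality holds at every point
  of the interval. Thus \<open>K\<close> selects a definite representative, which is continuous by
  the previous lemma on continuity.\<close>

lemma conv_operator_cong_AE:
  assumes "f \<in> L2_space M" "g \<in> L2_space M" "L2_eq M f g" "x \<in> {0..L}"
  shows "K f x = K g x"
  unfolding conv_operator_def
  using assms kernel_integrable[of f x] kernel_integrable[of g x]
  by (intro integral_cong_AE) (auto simp: L2_eq_def)

lemma conv_operator_add:
  assumes "f \<in> L2_space M" "g \<in> L2_space M" "x \<in> {0..L}"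
  shows "K (\<lambda>x. f x + g x) x = K f x + K g x"
  unfolding conv_operator_def
  using kernel_integrable[OF assms(1,3)] kernel_integrable[OF assms(2,3)]
  by (simp add: distrib_left)

lemma conv_operator_cmult: "K (\<lambda>x. c * f x) x = c * K f x"
  unfolding conv_operator_def by (simp add: mult.left_commute)

lemma conv_operator_bounded: "L2_bounded_operator M K"
proof -
  obtain H where H: "0 \<le> H"
    "\<And>f x. f \<in> L2_space M \<Longrightarrow> x \<in> {0..L} \<Longrightarrow> cmod (K f x) \<le> H * L2_norm M f"
    by (rule conv_operator_bound) blast
  have "L2_norm M (K f) \<le> sqrt L * H * L2_norm M f" if "f \<in> L2_space M" for f
    using L2_norm_le_bound[OF L2_space_continuous_on[OF conv_operator_continuous_on[OF that]] H(2)[OF that]]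
      L_pos by (simp add: mult.assoc)
  then show ?thesis
    unfolding L2_bounded_operator_def L2_eq_def[of _ "K _"]
    by (auto intro!: L2_space_continuous_on conv_operator_continuous_on AE_I2 conv_operator_cong_AE
        simp: conv_operator_add conv_operator_cmult L2_eq_def)
qed

text \<open>Arzela-Ascoli: the images of a bounded sequence are uniformly bounded and
  equicontinuous, and uniform convergence on a bounded interval implies convergence in norm.\<close>

lemma conv_operator_compact: "L2_compact_operator M K"
  unfolding L2_compact_operator_def
proof (intro conjI allI impI conv_operator_bounded)
  fix f :: "nat \<Rightarrow> real \<Rightarrow> complex"
  assume "(\<forall>n. f n \<in> L2_space M) \<and> (\<exists>B. \<forall>n. L2_norm M (f n) \<le> B)"
  then obtain B where f: "\<And>n. f n \<in> L2_space M" "\<And>n. L2_norm M (f n) \<le> B" by auto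
  obtain H where H: "0 \<le> H"
    "\<And>f x. f \<in> L2_space M \<Longrightarrow> x \<in> {0..L} \<Longrightarrow> cmod (K f x) \<le> H * L2_norm M f"
    by (rule conv_operator_bound) blast
  have bound: "norm (K (f n) x) \<le> H * B" if "x \<in> {0..L}" for n x
    using H(2)[OF f(1) that] mult_left_mono[OF f(2) H(1)] order_trans by blast
  have equi: "\<exists>d. 0 < d \<and> (\<forall>n y. y \<in> {0..L} \<and> norm (x - y) < d \<longrightarrow> norm (K (f n) x - K (f n) y) < e)"
    if "x \<in> {0..L}" "0 < e" for x e
    using conv_operator_equicontinuous[OF that(2), of B] f that(1) by (metis real_norm_def)
  obtain g k where g: "continuous_on {0..L} g" and k: "strict_mono (k :: nat \<Rightarrow> nat)"
    and lim: "\<And>e. 0 < e \<Longrightarrow> \<exists>N. \<forall>n x. n \<ge> N \<and> x \<in> {0..L} \<longrightarrow> norm (K (f (k n)) x - g x) < e"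
    using Arzela_Ascoli[of "{0..L}" "\<lambda>n. K (f n)" "H * B"] bound equi by (metis compact_Icc)
  have gL: "g \<in> L2_space M" by (rule L2_space_continuous_on[OF g])
  have "(\<lambda>n. L2_norm M (\<lambda>x. K (f (k n)) x - g x)) \<longlonglongrightarrow> 0"
  proof (rule LIMSEQ_I)
    fix e :: real assume e: "0 < e"
    \<comment> \<open>A uniform error \<open>e'\<close> costs a factor \<open>sqrt L\<close> in
      norm, so the total is \<open>e / 2\<close>.\<close>
    define e' where "e' = e / (2 * sqrt L)"
    have e': "0 < e'" using e L_pos by (simp add: e'_def)
    obtain N where N: "\<And>n x. n \<ge> N \<Longrightarrow> x \<in> {0..L} \<Longrightarrow> norm (K (f (k n)) x - g x) < e'"
      using lim[OF e'] by metis
    have "norm (L2_norm M (\<lambda>x. K (f (k n)) x - g x) - 0) < e" if n: "n \<ge> N" for n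
    proof -
      have "L2_norm M (\<lambda>x. K (f (k n)) x - g x) \<le> sqrt (L - 0) * e'"
        using N[OF n] L_pos L2_bounded_operatorD(1)[OF conv_operator_bounded f(1)] gL
        by (intro L2_norm_le_bound L2_space_diff) (auto intro: less_imp_le)
      also have "\<dots> < e" using e L_pos by (simp add: e'_def)
      finally show ?thesis by simp
    qed
    then show "\<exists>N. \<forall>n\<ge>N. norm (L2_norm M (\<lambda>x. K (f (k n)) x - g x) - 0) < e" by blast
  qed
  then show "\<exists>r g. strict_mono r \<and> g \<in> L2_space M \<and>
      (\<lambda>n. L2_norm M (\<lambda>x. K (f (r n)) x - g x)) \<longlonglongrightarrow> 0"
    using k gL by blast
qed

text \<open>Fubini exchanges the two integrations; the kernel \<open>h (x - y)\<close> is real and,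
  \<open>h\<close> being even, symmetric.\<close>

lemma conv_operator_selfadjoint: "L2_selfadjoint_operator M K"
  unfolding L2_selfadjoint_operator_def
proof (intro conjI ballI conv_operator_bounded)
  fix f g assume f: "f \<in> L2_space M" and g: "g \<in> L2_space M"
  interpret finite_measure M by (rule finite_measure_lebesgue_on) simp
  interpret P: pair_sigma_finite M M ..
  have [measurable]: "f \<in> borel_measurable M" "g \<in> borel_measurable M"
    using f g by (auto simp: L2_space_def)
  have id: "(\<lambda>x. x) \<in> borel_measurable M"
    using id_borel_measurable_lebesgue_on[of "{0..L}"] by (simp add: id_def)
  \<comment> \<open>Clamping the argument to \<open>[-L, L]\<close> extends \<open>h\<close> to a
    continuous, hence Borel measurable, bounded function on the whole line, which makes the kernel
    measurable on the product space.\<close>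
  define k where "k u = h (max (-L) (min L u))" for u
  have k: "k u = h u" if "u \<in> {-L..L}" for u using that by (auto simp: k_def max_def min_def)
  have "continuous_on UNIV k"
    unfolding k_def by (intro continuous_on_compose2[OF cont_h] continuous_intros) (use L_pos in auto)
  then have [measurable]: "k \<in> borel_measurable borel" by (rule borel_measurable_continuous_onI)
  obtain H where H: "\<And>u. u \<in> {-L..L} \<Longrightarrow> \<bar>h u\<bar> \<le> H"
    by (rule h_bounded) blast
  have kH: "\<bar>k u\<bar> \<le> H" for u unfolding k_def by (rule H) (use L_pos in auto)
  define \<Phi> where "\<Phi> x y = complex_of_real (k (x - y)) * f y * cnj (g x)" for x y
  have "(\<lambda>z. fst z - snd z) \<in> borel_measurable (M \<Otimes>\<^sub>M M)"
    by (intro borel_measurable_diff measurable_compose[OF measurable_fst id] measurable_compose[OF measurable_snd id])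
  then have "(\<lambda>z. k (fst z - snd z)) \<in> borel_measurable (M \<Otimes>\<^sub>M M)"
    by (rule measurable_compose) simp
  then have \<Phi>_meas: "case_prod \<Phi> \<in> borel_measurable (M \<Otimes>\<^sub>M M)"
    unfolding \<Phi>_def split_beta by measurable
  have fg: "integrable M f" "integrable M g"
    using L2_space_integrable(1)[OF f] L2_space_integrable(1)[OF g] L_pos by auto
  \<comment> \<open>The dominating function is a product of integrable functions of separate
    variables.\<close>
  have "integrable (M \<Otimes>\<^sub>M M) (\<lambda>z. complex_of_real H * (g (fst z) * f (snd z)))"
    using fg by (intro P.Fubini_integrable) (auto simp: norm_mult)
  then have "integrable (M \<Otimes>\<^sub>M M) (case_prod \<Phi>)"
    by (rule Bochner_Integration.integrable_bound[OF _ \<Phi>_meas])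
       (auto simp: \<Phi>_def norm_mult split_beta mult.assoc mult.commute[of "cmod (g _)"]
         intro!: mult_right_mono order_trans[OF kH abs_ge_self] AE_I2)
  then have sw: "(LINT y|M. LINT x|M. \<Phi> x y) = (LINT x|M. LINT y|M. \<Phi> x y)"
    by (rule P.Fubini_integral)
  have "L2_inner M (K f) g = (LINT x|M. LINT y|M. \<Phi> x y)"
    unfolding L2_inner_def conv_operator_def
  proof (rule Bochner_Integration.integral_cong[OF refl])
    fix x assume "x \<in> space M"
    then have "(LINT y|M. complex_of_real (h (x - y)) * f y) = (LINT y|M. complex_of_real (k (x - y)) * f y)"
      by (intro Bochner_Integration.integral_cong[OF refl]) (simp add: k)
    then show "(LINT y|M. complex_of_real (h (x - y)) * f y) * cnj (g x) = (LINT y|M. \<Phi> x y)"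
      by (simp add: \<Phi>_def)
  qed
  also have "\<dots> = (LINT y|M. LINT x|M. \<Phi> x y)" by (rule sw[symmetric])
  also have "\<dots> = L2_inner M f (K g)"
    unfolding L2_inner_def conv_operator_def
  proof (rule Bochner_Integration.integral_cong[OF refl])
    fix y assume y: "y \<in> space M"
    have "cnj (LINT x|M. complex_of_real (h (y - x)) * g x)
        = (LINT x|M. cnj (complex_of_real (h (y - x)) * g x))"
      by (rule Bochner_Integration.integral_cnj[symmetric])
    \<comment> \<open>Evenness enters here, replacing \<open>h (y - x)\<close> by
      \<open>h (x - y)\<close>; conjugation leaves the real kernel unchanged.\<close>
    also have "\<dots> = (LINT x|M. complex_of_real (k (x - y)) * cnj (g x))"
      by (intro Bochner_Integration.integral_cong[OF refl]) (use y kernel_even in \<open>simp add: k\<close>)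
    finally show "(LINT x|M. \<Phi> x y) = f y * cnj (LINT x|M. complex_of_real (h (y - x)) * g x)"
      by (simp add: \<Phi>_def mult.assoc mult.left_commute[of _ "f y"])
  qed
  finally show "L2_inner M (K f) g = L2_inner M f (K g)" .
qed

end

subsection \<open>Zeros of the Fourier transform\<close>

lemma integral_lebesgue_on_Icc:
  fixes f :: "real \<Rightarrow> complex"
  assumes "continuous_on {a..b} f"
  shows "integral\<^sup>L (lebesgue_on {a..b}) f = integral {a..b} f"
  by (rule lebesgue_integral_eq_integral[OF continuous_imp_integrable_real[OF assms]]) auto

text \<open>Integration by parts. The boundary condition is placed on the product, since in its
  applications only one factor is known to vanish at the end points.\<close>

lemma integral_product_rule_zero_boundary:
  fixes u v :: "real \<Rightarrow> complex"
  assumes "a \<le> b"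
    and du: "\<And>x. x \<in> {a..b} \<Longrightarrow> (u has_vector_derivative u' x) (at x within {a..b})"
    and dv: "\<And>x. x \<in> {a..b} \<Longrightarrow> (v has_vector_derivative v' x) (at x within {a..b})"
    and "u a * v a = 0" "u b * v b = 0"
  shows "((\<lambda>x. u x * v' x + u' x * v x) has_integral 0) {a..b}"
  using fundamental_theorem_of_calculus[OF assms(1) has_vector_derivative_mult[OF du dv]] assms(4,5)
  by simp

text \<open>The integrating factor \<open>exp (- c t)\<close> makes \<open>g t * E t\<close>
  constant, and its value at \<open>a\<close> is 0.\<close>

lemma linear_ode_zero:
  fixes g :: "real \<Rightarrow> complex"
  assumes der: "\<And>x. x \<in> {a..b} \<Longrightarrow> (g has_vector_derivative c * g x) (at x within {a..b})"
    and "g a = 0" "x \<in> {a..b}"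
  shows "g x = 0"
proof -
  define E where "E t = exp (- c * complex_of_real t)" for t
  have E: "(E has_vector_derivative - c * E t) (at t within {a..b})" for t
    unfolding E_def
    by (rule has_vector_derivative_real_field) (auto intro!: derivative_eq_intros)
  have "((\<lambda>t. g t * E t) has_vector_derivative 0) (at t within {a..b})" if "t \<in> {a..b}" for t
    using has_vector_derivative_mult[OF der[OF that] E] by (simp add: algebra_simps)
  then obtain k where "\<And>t. t \<in> {a..b} \<Longrightarrow> g t * E t = k"
    using has_vector_derivative_zero_constant[of "{a..b}" "\<lambda>t. g t * E t"] by (metis convex_real_interval(5))
  then have "g x * E x = g a * E a" using assms(3) by (metis atLeastAtMost_iff order_refl order_trans)
  then show ?thesis using assms(2) by (simp add: E_def)
qed

text \<open>Replaces \<open>\<xi>\<close> by a continuous representative, so that the transform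
  becomes an ordinary integral to which the fundamental theorem and the Leibniz rule apply.\<close>

lemma fourier_transform_extend_by_zero:
  fixes \<eta> :: "real \<Rightarrow> complex"
  assumes meas: "\<xi> \<in> borel_measurable (lebesgue_on {0..L})"
    and cont: "continuous_on {0..L} \<eta>"
    and ae: "AE x in lebesgue_on {0..L}. \<xi> x = \<eta> x"
  shows "fourier_transform (extend_by_zero {0..L} \<xi>) s
    = integral {0..L} (\<lambda>x. \<eta> x * exp (- (\<i> * s * complex_of_real x)))"
proof -
  define e where "e x = exp (- (\<i> * s * complex_of_real x))" for x
  have ce: "continuous_on {0..L} e" unfolding e_def by (intro continuous_intros)
  have [measurable]: "e \<in> borel_measurable (lebesgue_on {0..L})"
    "\<eta> \<in> borel_measurable (lebesgue_on {0..L})" "\<xi> \<in> borel_measurable (lebesgue_on {0..L})"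
    using ce cont meas by (auto intro: continuous_imp_measurable_on_sets_lebesgue)
  have "fourier_transform (extend_by_zero {0..L} \<xi>) s
      = (LINT x|lebesgue. indicator {0..L} x *\<^sub>R (\<xi> x * e x))"
    unfolding fourier_transform_def e_def
    by (rule Bochner_Integration.integral_cong) (auto simp: extend_by_zero_def)
  also have "\<dots> = (LINT x|lebesgue_on {0..L}. \<xi> x * e x)"
    by (rule integral_restrict_space[symmetric]) simp
  also have "\<dots> = (LINT x|lebesgue_on {0..L}. \<eta> x * e x)"
    using ae by (intro integral_cong_AE) auto
  also have "\<dots> = integral {0..L} (\<lambda>x. \<eta> x * e x)"
    by (intro integral_lebesgue_on_Icc continuous_intros cont ce)
  finally show ?thesis by (simp add: e_def)
qed

text \<open>Differentiation under the integral sign: the integrand is entire in \<open>s\<close>,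
  with a derivative jointly continuous in \<open>s\<close> and \<open>x\<close>.\<close>

lemma holomorphic_on_finite_fourier_integral:
  fixes \<eta> :: "real \<Rightarrow> complex"
  assumes cont: "continuous_on {a..b} \<eta>"
  shows "(\<lambda>s. integral {a..b} (\<lambda>x. \<eta> x * exp (- (\<i> * s * complex_of_real x)))) holomorphic_on UNIV"
proof -
  have "(\<lambda>s. integral (cbox a b) (\<lambda>x. \<eta> x * exp (- (\<i> * s * complex_of_real x)))) holomorphic_on UNIV"
  proof (rule leibniz_rule_holomorphic)
    show "((\<lambda>s. \<eta> t * exp (- (\<i> * s * complex_of_real t))) has_field_derivative
        \<eta> t * (exp (- (\<i> * s * complex_of_real t)) * (- (\<i> * complex_of_real t)))) (at s within UNIV)" for s t
      by (auto intro!: derivative_eq_intros)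
    show "(\<lambda>x. \<eta> x * exp (- (\<i> * s * complex_of_real x))) integrable_on cbox a b" for s
      by (intro integrable_continuous continuous_intros) (use cont in simp)
    have "continuous_on (UNIV \<times> cbox a b) (\<lambda>z. \<eta> (snd z))"
      by (intro continuous_on_compose2[OF cont] continuous_intros) auto
    then show "continuous_on (UNIV \<times> cbox a b)
        (\<lambda>(s, t). \<eta> t * (exp (- (\<i> * s * complex_of_real t)) * (- (\<i> * complex_of_real t))))"
      unfolding split_beta by (intro continuous_intros)
  qed simp
  then show ?thesis by simp
qed

context even_convolution_kernel
begin

section \<open>Convolution, differentiation, and the extremal eigenfunction\<close>

lemma conv_operator_eq_integral:
  assumes "continuous_on {0..L} f" "x \<in> {0..L}"
  shows "K f x = integral {0..L} (\<lambda>y. complex_of_real (h (x - y)) * f y)"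
  unfolding conv_operator_def
  by (intro integral_lebesgue_on_Icc continuous_intros continuous_on_compose2[OF cont_h] assms(1))
    (use assms(2) in auto)

lemma L2_inner_eq_integral:
  assumes "continuous_on {0..L} f" "continuous_on {0..L} g"
  shows "L2_inner M f g = integral {0..L} (\<lambda>x. f x * cnj (g x))"
  unfolding L2_inner_def by (intro integral_lebesgue_on_Icc continuous_intros assms)

text \<open>Integrating by parts against a primitive \<open>H\<close> of \<open>h\<close> moves the derivative onto \<open>g\<close>, so that
  no differentiability of \<open>h\<close> is needed.\<close>

lemma conv_operator_has_vector_derivative:
  assumes dg: "\<And>x. x \<in> {0..L} \<Longrightarrow> (g has_vector_derivative g' x) (at x within {0..L})"
    and cg': "continuous_on {0..L} g'" and bd: "g 0 = 0" "g L = 0" and x: "x \<in> {0..L}"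
  shows "(K g has_vector_derivative K g' x) (at x within {0..L})"
proof -
  have cg: "continuous_on {0..L} g"
    by (rule continuous_on_vector_derivative[OF dg])
  \<comment> \<open>The primitive starts at \<open>-L\<close> so that it is defined at every
    difference of two points of \<open>[0, L]\<close>.\<close>
  define H where "H u = complex_of_real (integral {-L..u} h)" for u
  have H: "(H has_vector_derivative complex_of_real (h u)) (at u within {-L..L})"
    if "u \<in> {-L..L}" for u
    unfolding H_def using integral_has_vector_derivative[OF cont_h that]
    by (rule bounded_linear.has_vector_derivative[OF bounded_linear_of_real])
  have cH: "continuous_on {-L..L} H"
    by (rule continuous_on_vector_derivative[OF H])
  have Hy: "((\<lambda>y. H (z - y)) has_vector_derivative - complex_of_real (h (z - y))) (at y within {0..L})"
    if "z \<in> {0..L}" "y \<in> {0..L}" for z y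
  proof -
    have "((\<lambda>y. z - y) has_vector_derivative -1) (at y within {0..L})"
      by (auto intro!: derivative_eq_intros)
    moreover have "(H has_vector_derivative complex_of_real (h (z - y))) (at (z - y) within (\<lambda>y. z - y) ` {0..L})"
      by (rule has_vector_derivative_within_subset[OF H]) (use that in auto)
    ultimately show ?thesis
      using vector_diff_chain_within[of "\<lambda>y. z - y" "-1" y "{0..L}" H] by (simp add: o_def)
  qed
  have Hx: "((\<lambda>z. H (z - y) * g' y) has_vector_derivative complex_of_real (h (z - y)) * g' y) (at z within {0..L})"
    if "z \<in> {0..L}" "y \<in> {0..L}" for z y
  proof -
    have "((\<lambda>z. z - y) has_vector_derivative 1) (at z within {0..L})"
      by (auto intro!: derivative_eq_intros)
    moreover have "(H has_vector_derivative complex_of_real (h (z - y))) (at (z - y) within (\<lambda>z. z - y) ` {0..L})"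
      by (rule has_vector_derivative_within_subset[OF H]) (use that in auto)
    ultimately have "((\<lambda>z. H (z - y)) has_vector_derivative complex_of_real (h (z - y))) (at z within {0..L})"
      using vector_diff_chain_within[of "\<lambda>z. z - y" 1 z "{0..L}" H] by (simp add: o_def)
    then show ?thesis
      by (rule has_vector_derivative_mult_left)
  qed
  have cHg: "continuous_on {0..L} (\<lambda>y. H (z - y) * g' y)" if "z \<in> {0..L}" for z
    by (intro continuous_intros continuous_on_compose2[OF cH] cg') (use that in auto)
  \<comment> \<open>As \<open>g\<close> vanishes at 0 and \<open>L\<close>, integrating by parts
    produces no boundary term. In the resulting formula for \<open>K g z\<close> the variable
    \<open>z\<close> occurs only inside \<open>H\<close>, which is differentiable.\<close>
  have parts: "integral {0..L} (\<lambda>y. H (z - y) * g' y) = K g z" if z: "z \<in> {0..L}" for z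
  proof -
    have chg: "continuous_on {0..L} (\<lambda>y. complex_of_real (h (z - y)) * g y)"
      by (intro continuous_intros continuous_on_compose2[OF cont_h] cg) (use z in auto)
    have "((\<lambda>y. H (z - y) * g' y + (- complex_of_real (h (z - y))) * g y) has_integral 0) {0..L}"
      by (rule integral_product_rule_zero_boundary[OF _ Hy[OF z] dg]) (use L_pos bd in auto)
    then have "integral {0..L} (\<lambda>y. H (z - y) * g' y - complex_of_real (h (z - y)) * g y) = 0"
      by (simp add: integral_unique)
    moreover have "integral {0..L} (\<lambda>y. H (z - y) * g' y - complex_of_real (h (z - y)) * g y)
        = integral {0..L} (\<lambda>y. H (z - y) * g' y) - integral {0..L} (\<lambda>y. complex_of_real (h (z - y)) * g y)"
      by (intro Henstock_Kurzweil_Integration.integral_diff integrable_continuous_real cHg[OF z] chg)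
    ultimately show ?thesis by (simp add: conv_operator_eq_integral[OF cg z])
  qed
  have "((\<lambda>z. integral (cbox 0 L) (\<lambda>y. H (z - y) * g' y)) has_vector_derivative
      integral (cbox 0 L) (\<lambda>y. complex_of_real (h (x - y)) * g' y)) (at x within {0..L})"
  proof (rule leibniz_rule_vector_derivative)
    have "continuous_on ({0..L} \<times> cbox 0 L) (\<lambda>z. g' (snd z))"
      by (intro continuous_on_compose2[OF cg'] continuous_intros) auto
    moreover have "continuous_on ({0..L} \<times> cbox 0 L) (\<lambda>z. h (fst z - snd z))"
      by (intro continuous_on_compose2[OF cont_h] continuous_intros) auto
    ultimately show "continuous_on ({0..L} \<times> cbox 0 L) (\<lambda>(z, y). complex_of_real (h (z - y)) * g' y)"
      unfolding split_beta by (intro continuous_intros)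
  qed (use Hx cHg x in \<open>auto intro: integrable_continuous_real\<close>)
  then have "((\<lambda>z. integral {0..L} (\<lambda>y. H (z - y) * g' y)) has_vector_derivative K g' x) (at x within {0..L})"
    by (simp add: conv_operator_eq_integral[OF cg' x])
  then show ?thesis
    by (rule has_vector_derivative_transform[rotated 2]) (use x parts in auto)
qed

text \<open>Differentiation is skew-adjoint. The vanishing at the end points is asked of
  \<open>v\<close>, which lets \<open>u\<close> be \<open>K g\<close>, whose end values are not
  controlled.\<close>

lemma L2_inner_derivative_skew:
  assumes du: "\<And>x. x \<in> {0..L} \<Longrightarrow> (u has_vector_derivative u' x) (at x within {0..L})"
    and dv: "\<And>x. x \<in> {0..L} \<Longrightarrow> (v has_vector_derivative v' x) (at x within {0..L})"
    and cu': "continuous_on {0..L} u'" and cv': "continuous_on {0..L} v'" and bd: "v 0 = 0" "v L = 0"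
  shows "L2_inner M u' v + L2_inner M u v' = 0"
proof -
  have c: "continuous_on {0..L} u" "continuous_on {0..L} v"
    by (rule continuous_on_vector_derivative[OF du] continuous_on_vector_derivative[OF dv]; assumption)+
  have "((\<lambda>x. u x * cnj (v' x) + u' x * cnj (v x)) has_integral 0) {0..L}"
    by (rule integral_product_rule_zero_boundary[OF _ du has_vector_derivative_cnj[OF dv]])
      (use L_pos bd in auto)
  then have "0 = integral {0..L} (\<lambda>x. u x * cnj (v' x) + u' x * cnj (v x))"
    by (simp add: integral_unique)
  also have "\<dots> = integral {0..L} (\<lambda>x. u x * cnj (v' x)) + integral {0..L} (\<lambda>x. u' x * cnj (v x))"
    by (intro Henstock_Kurzweil_Integration.integral_add integrable_continuous_real continuous_intros c cu' cv')
  finally show ?thesis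
    using c cu' cv' by (simp add: L2_inner_eq_integral add.commute)
qed

text \<open>If the largest modulus were 0, the norm bound would force \<open>K = 0\<close>. The
  eigenspace of 0 would then contain the independent functions 1 and \<open>x\<close>, against
  simplicity. A nonzero \<open>\<mu>\<close> is what allows \<open>K \<xi> / \<mu>\<close> as a
  continuous representative of \<open>\<xi>\<close>.\<close>

lemma L2_largest_simple_eigenvalue_nonzero:
  assumes largest: "L2_largest_eigenvalue M K \<mu>" and simple: "L2_simple_eigenvalue M K \<mu>"
  shows "\<mu> \<noteq> 0"
proof
  assume \<mu>: "\<mu> = 0"
  have K0: "L2_eq M (K f) (\<lambda>x. 0)" if f: "f \<in> L2_space M" for f
  proof -
    have "L2_norm M (K f) \<le> 0 * L2_norm M f"
      using largest \<mu> by (intro L2_selfadjoint_norm_le conv_operator_compact conv_operator_selfadjoint f)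
        (auto simp: L2_largest_eigenvalue_def)
    then have "L2_norm M (K f) = 0" by (simp add: order_antisym)
    then show ?thesis
      using L2_norm_eq_0_iff[OF L2_bounded_operatorD(1)[OF conv_operator_bounded f]] by simp
  qed
  have cont: "continuous_on {0..L} f \<Longrightarrow> f \<in> L2_eigenspace M K 0" for f
    using K0[OF L2_space_continuous_on] by (simp add: L2_eigenspace_def L2_space_continuous_on)
  obtain f where f: "\<And>g. g \<in> L2_eigenspace M K \<mu> \<Longrightarrow> \<exists>c. L2_eq M g (\<lambda>x. c * f x)"
    using simple by (auto simp: L2_simple_eigenvalue_def)
  obtain a where a: "AE x in M. 1 = a * f x"
    using f[of "\<lambda>x. 1"] cont[of "\<lambda>x. 1"] \<mu> by (auto simp: L2_eq_def)
  obtain b where b: "AE x in M. complex_of_real x = b * f x"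
    using f[of complex_of_real] cont[of complex_of_real] \<mu>
    by (auto simp: L2_eq_def intro: continuous_intros)
  have "AE x in M. a * complex_of_real x = b"
    using a b by eventually_elim (metis mult.left_commute mult.right_neutral)
  then have *: "a * complex_of_real x = b" if "x \<in> {0..L}" for x
    using that L_pos by (intro continuous_AE_eq_imp_eq[of 0 L _ "\<lambda>_. b"]) (auto intro!: continuous_intros)
  have "b = 0" using *[of 0] L_pos by simp
  then have "a = 0" using *[of L] L_pos by simp
  then have "AE x in M. (1::complex) = 0" using a by simp
  then have "(1::complex) = 0"
    using L_pos by (intro continuous_AE_eq_imp_eq[of 0 L "\<lambda>_. 1" "\<lambda>_. 0" 0]) auto
  then show False by simp
qed

text \<open>Formulated for a continuous eigenfunction with a pointwise eigenvalue equation, as the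
  calculus arguments require.\<close>

lemma largest_simple_eigenfunction_zeros_real:
  assumes largest: "L2_largest_eigenvalue M K \<mu>" and simple: "L2_simple_eigenvalue M K \<mu>"
    and c\<eta>: "continuous_on {0..L} \<eta>" and K\<eta>: "\<And>x. x \<in> {0..L} \<Longrightarrow> K \<eta> x = \<mu> * \<eta> x"
    and nz: "\<not> L2_eq M \<eta> (\<lambda>x. 0)"
    and zero: "integral {0..L} (\<lambda>x. \<eta> x * exp (- (\<i> * s * complex_of_real x))) = 0"
  shows "s \<in> \<real>"
proof (rule ccontr)
  assume "s \<notin> \<real>"
  then have s: "Im s \<noteq> 0" by (simp add: complex_is_Real_iff)
  define e where "e x = exp (\<i> * s * complex_of_real x)" for x
  define g where "g x = e x * integral {0..x} (\<lambda>x. \<eta> x * exp (- (\<i> * s * complex_of_real x)))" for x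
  define g' where "g' x = \<i> * s * g x + \<eta> x" for x
  have de: "(e has_vector_derivative \<i> * s * e x) (at x within {0..L})" for x
    unfolding e_def by (rule has_vector_derivative_real_field) (auto intro!: derivative_eq_intros)
  have dg: "(g has_vector_derivative g' x) (at x within {0..L})" if "x \<in> {0..L}" for x
  proof -
    have "((\<lambda>u. integral {0..u} (\<lambda>x. \<eta> x * exp (- (\<i> * s * complex_of_real x))))
        has_vector_derivative \<eta> x * exp (- (\<i> * s * complex_of_real x))) (at x within {0..L})"
      by (intro integral_has_vector_derivative continuous_intros c\<eta> that)
    from has_vector_derivative_mult[OF de this] show ?thesis
      unfolding g_def g'_def by (simp add: e_def exp_minus field_simps)
  qed
  have g0: "g 0 = 0" and gL: "g L = 0" using zero by (simp_all add: g_def)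
  have cg: "continuous_on {0..L} g"
    by (rule continuous_on_vector_derivative[OF dg])
  have cg': "continuous_on {0..L} g'" unfolding g'_def by (intro continuous_intros cg c\<eta>)
  have L2: "g \<in> L2_space M" "g' \<in> L2_space M" "\<eta> \<in> L2_space M"
    by (intro L2_space_continuous_on cg cg' c\<eta>)+
  note KI = L2_bounded_operatorD(1)[OF conv_operator_bounded]
  define m where "m = Re \<mu>"
  have \<mu>: "\<mu> = complex_of_real m"
    using largest L2_eigenvalue_selfadjoint_real[OF conv_operator_selfadjoint]
    by (simp add: m_def L2_largest_eigenvalue_def)
  have sym: "L2_inner M (K u) v = L2_inner M u (K v)" if "u \<in> L2_space M" "v \<in> L2_space M" for u v
    using conv_operator_selfadjoint that by (simp add: L2_selfadjoint_operator_def)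
  have K\<eta>': "L2_eq M (K \<eta>) (\<lambda>x. \<mu> * \<eta> x)" using K\<eta> by (auto simp: L2_eq_def intro: AE_I2)
  have expand_l: "L2_inner M g' v = \<i> * s * L2_inner M g v + L2_inner M \<eta> v" if "v \<in> L2_space M" for v
    unfolding g'_def using L2 that
    by (simp add: L2_inner_add_left L2_space_cmult L2_inner_cmult_left)
  have expand_r: "L2_inner M v g' = cnj (\<i> * s) * L2_inner M v g + L2_inner M v \<eta>" if "v \<in> L2_space M" for v
    unfolding g'_def using L2 that
    by (simp add: L2_inner_add_right L2_space_cmult L2_inner_cmult_right)
  \<comment> \<open>\<open>\<eta>\<close> lies in the kernel of the form
    \<open><K u, v> - \<mu> <u, v>\<close>. On the right-hand side the scalar comes out conjugated,
    which is harmless because \<open>\<mu>\<close> is real.\<close>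
  have \<eta>K: "L2_inner M \<eta> (K g) = \<mu> * L2_inner M \<eta> g" "L2_inner M (K g) \<eta> = \<mu> * L2_inner M g \<eta>"
  proof -
    have r: "L2_eq M g g" by (simp add: L2_eq_def)
    note sp = KI[OF L2(3)] L2_space_cmult[OF L2(3), of \<mu>] L2(1)
    show "L2_inner M \<eta> (K g) = \<mu> * L2_inner M \<eta> g"
      using L2_inner_cong[OF sp(1,2,3,3) K\<eta>' r] by (simp add: sym[symmetric] L2 L2_inner_cmult_left)
    show "L2_inner M (K g) \<eta> = \<mu> * L2_inner M g \<eta>"
      using L2_inner_cong[OF sp(3,3,1,2) r K\<eta>'] by (simp add: sym L2 L2_inner_cmult_right \<mu>)
  qed
  \<comment> \<open>Skew-adjointness for the pair \<open>K g\<close>, \<open>g\<close>, with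
    \<open>K g'\<close> as the derivative of \<open>K g\<close>.\<close>
  have "L2_inner M (K g') g + L2_inner M (K g) g' = 0"
    by (intro L2_inner_derivative_skew conv_operator_has_vector_derivative dg cg' g0 gL
        conv_operator_continuous_on L2)
  then have "(\<i> * s + cnj (\<i> * s)) * L2_inner M (K g) g + \<mu> * (L2_inner M \<eta> g + L2_inner M g \<eta>) = 0"
    using expand_l[OF KI[OF L2(1)]] expand_r[OF KI[OF L2(1)]] sym[OF L2(2,1)] sym[OF L2(1,1)] \<eta>K
    by (simp add: algebra_simps)
  moreover have "L2_inner M g' g + L2_inner M g g' = 0"
    by (intro L2_inner_derivative_skew dg cg' g0 gL)
  then have "(\<i> * s + cnj (\<i> * s)) * L2_inner M g g + (L2_inner M \<eta> g + L2_inner M g \<eta>) = 0"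
    using expand_l[OF L2(1)] expand_r[OF L2(1)] by (simp add: algebra_simps)
  \<comment> \<open>Subtracting \<open>\<mu>\<close> times the second identity from the first
    cancels the mixed terms in \<open>\<eta>\<close> and \<open>g\<close>. The remaining factor
    \<open>\<i> s + cnj (\<i> s)\<close> equals \<open>-2 Im s\<close>.\<close>
  ultimately have "(\<i> * s + cnj (\<i> * s)) * (L2_inner M (K g) g - \<mu> * L2_inner M g g) = 0"
    by algebra
  moreover have "\<i> * s + cnj (\<i> * s) \<noteq> 0" using s by (simp add: complex_eq_iff)
  ultimately have "L2_inner M (K g) g = complex_of_real m * L2_inner M g g" by (simp add: \<mu>)
  \<comment> \<open>The maximality of \<open>|\<mu>|\<close> enters here: it makes
    \<open>|m|\<close> a bound for the norm of \<open>K\<close>.\<close>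
  moreover have "L2_norm M (K g) \<le> \<bar>m\<bar> * L2_norm M g"
    using largest \<mu> by (intro L2_selfadjoint_norm_le conv_operator_compact conv_operator_selfadjoint L2)
      (auto simp: L2_largest_eigenvalue_def)
  ultimately have "g \<in> L2_eigenspace M K \<mu>"
    unfolding \<mu> by (intro L2_eigenspace_if_Rayleigh_eq conv_operator_bounded L2)
  moreover have "\<eta> \<in> L2_eigenspace M K \<mu>" using L2 K\<eta>' by (simp add: L2_eigenspace_def)
  ultimately obtain f a b where a: "AE x in M. g x = a * f x" and b: "AE x in M. \<eta> x = b * f x"
    using simple unfolding L2_simple_eigenvalue_def L2_eq_def by blast
  have b0: "b \<noteq> 0" using nz b by (auto simp: L2_eq_def)
  have "AE x in M. b * g x = a * \<eta> x" using a b by eventually_elim (simp add: mult.left_commute)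
  then have proportional: "b * g x = a * \<eta> x" if "x \<in> {0..L}" for x
    using that L_pos by (intro continuous_AE_eq_imp_eq[of 0 L]) (auto intro!: continuous_intros cg c\<eta>)
  have gz: "g x = 0" if x: "x \<in> {0..L}" for x
  proof (cases "a = 0")
    case True
    then show ?thesis using proportional[OF x] b0 by simp
  next
    case False
    \<comment> \<open>Proportionality gives \<open>\<eta> = (b / a) g\<close>, which makes the
      equation for \<open>g\<close> homogeneous.\<close>
    have "g' x = (\<i> * s + b / a) * g x" if "x \<in> {0..L}" for x
      using proportional[OF that] False by (simp add: g'_def field_simps)
    then show ?thesis using linear_ode_zero[of 0 L g "\<i> * s + b / a"] dg g0 x by simp
  qed
  have "\<eta> x = 0" if x: "x \<in> {0..L}" for x
  proof -
    \<comment> \<open>\<open>g\<close> coincides with the zero function on the interval, so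
      uniqueness of derivatives within it, one-sided at the end points, gives
      \<open>g' x = 0\<close>.\<close>
    have "((\<lambda>_. 0) has_vector_derivative g' x) (at x within {0..L})"
      by (rule has_vector_derivative_transform[OF x _ dg[OF x]]) (simp add: gz)
    then have "g' x = 0"
      using vector_derivative_unique_within[of x "{0..L}" "\<lambda>_. 0" "g' x" 0] L_pos x
      by (simp add: trivial_limit_within islimpt_Icc)
    then show ?thesis by (simp add: g'_def gz[OF x])
  qed
  then show False using nz by (auto simp: L2_eq_def intro: AE_I2)
qed

end

theorem theorem3p1:
  fixes L :: real and h :: "real \<Rightarrow> real"
  assumes "L > 0"
    and "continuous_on {-L..L} h"
    and "\<forall>x\<in>{-L..L}. h (- x) = h x"
  shows "L2_compact_operator (lebesgue_on {0..L}) (conv_operator h L) \<and>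
    L2_selfadjoint_operator (lebesgue_on {0..L}) (conv_operator h L) \<and>
    (\<forall>\<mu> \<xi>.
       L2_largest_eigenvalue (lebesgue_on {0..L}) (conv_operator h L) \<mu> \<and>
       L2_simple_eigenvalue (lebesgue_on {0..L}) (conv_operator h L) \<mu> \<and>
       L2_eigenvector (lebesgue_on {0..L}) (conv_operator h L) \<mu> \<xi> \<longrightarrow>
         fourier_transform (extend_by_zero {0..L} \<xi>) holomorphic_on UNIV \<and>
         (\<forall>s. fourier_transform (extend_by_zero {0..L} \<xi>) s = 0 \<longrightarrow> s \<in> \<real>))"
proof (intro conjI allI impI; (elim conjE)?)
  interpret even_convolution_kernel L h by standard (use assms in auto)
  show "L2_compact_operator M K" by (rule conv_operator_compact)
  show "L2_selfadjoint_operator M K" by (rule conv_operator_selfadjoint)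
  fix \<mu> \<xi>
  assume largest: "L2_largest_eigenvalue M K \<mu>" and simple: "L2_simple_eigenvalue M K \<mu>"
    and "L2_eigenvector M K \<mu> \<xi>"
  then have \<xi>: "\<xi> \<in> L2_space M" "L2_eq M (K \<xi>) (\<lambda>x. \<mu> * \<xi> x)" "\<not> L2_eq M \<xi> (\<lambda>x. 0)"
    by (auto simp: L2_eigenvector_def L2_eigenspace_def)
  have \<mu>: "\<mu> \<noteq> 0" by (rule L2_largest_simple_eigenvalue_nonzero[OF largest simple])
  \<comment> \<open>The continuous representative of \<open>\<xi>\<close> read off from the
    eigenvalue equation. Since \<open>K\<close> takes equal values on \<open>\<xi>\<close> and
    \<open>\<eta>\<close>, the equation for \<open>\<eta>\<close> holds at every point.\<close>
  define \<eta> where "\<eta> x = K \<xi> x / \<mu>" for x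
  have c\<eta>: "continuous_on {0..L} \<eta>"
    unfolding \<eta>_def using \<mu> by (intro continuous_intros conv_operator_continuous_on \<xi>) auto
  have ae: "AE x in M. \<xi> x = \<eta> x"
    using \<xi>(2) unfolding L2_eq_def \<eta>_def by eventually_elim (simp add: \<mu>)
  have K\<eta>: "K \<eta> x = \<mu> * \<eta> x" if "x \<in> {0..L}" for x
    using conv_operator_cong_AE[OF \<xi>(1) L2_space_continuous_on[OF c\<eta>] _ that] ae \<mu>
    by (simp add: L2_eq_def \<eta>_def)
  have nz: "\<not> L2_eq M \<eta> (\<lambda>x. 0)"
  proof
    assume "L2_eq M \<eta> (\<lambda>x. 0)"
    then have "L2_eq M \<xi> (\<lambda>x. 0)" using ae unfolding L2_eq_def by eventually_elim simp
    then show False using \<xi>(3) by contradiction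
  qed
  have F: "fourier_transform (extend_by_zero {0..L} \<xi>)
      = (\<lambda>s. integral {0..L} (\<lambda>x. \<eta> x * exp (- (\<i> * s * complex_of_real x))))"
    using \<xi>(1) by (intro ext fourier_transform_extend_by_zero c\<eta> ae) (simp add: L2_space_def)
  show "fourier_transform (extend_by_zero {0..L} \<xi>) holomorphic_on UNIV"
    unfolding F by (rule holomorphic_on_finite_fourier_integral[OF c\<eta>])
  show "s \<in> \<real>" if "fourier_transform (extend_by_zero {0..L} \<xi>) s = 0" for s
    by (rule largest_simple_eigenfunction_zeros_real[OF largest simple c\<eta> _ nz that[unfolded F]])
      (rule K\<eta>)
qed

end
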